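(* Let $\mu, a, T > 0$ be arbitrary and let $P_x, P_z:\mathbb{R}\to\mathbb{R}$ be arbitrary $T$-periodic $C^\infty$ functions. Then there exists $\varepsilon = 1/k$ with $k\in\mathbb{N}$, $k\ge 1$, such that, for $h(t) = a\varepsilon\sin\left(\frac{2\pi}{T}\frac{t}{\varepsilon}\right)$, the system of ordinary differential equations \begin{align*} \dot\theta &= p_\theta + \dot h\sin\theta\sin\varphi,\\ \dot\varphi &= (p_\varphi - \dot h\cos\theta\cos\varphi)/\cos^2\theta,\\ \dot p_\theta &= -\dot\varphi^2\cos\theta\sin\theta - \dot h\dot\theta\cos\theta\sin\varphi - \dot h\dot\varphi\sin\theta\cos\varphi - \mu\dot\theta + \sin\theta\sin\varphi - P_x(t)\sin\theta\cos\varphi + P_z(t)\cos\theta,\\ \dot p_\varphi &= -\dot h\dot\theta\sin\theta\cos\varphi - \dot h\dot\varphi\cos\theta\sin\varphi - \cos\theta\cos\varphi - \mu\dot\varphi\cos^2\theta - P_x(t)\cos\theta\sin\varphi \end{align*} has a $T$-periodic solution $(\theta(t),\varphi(t),p_\theta(t),p_\varphi(t))$, defined for all $t\in\mathbb{R}$, satisfying $\cos\theta(t)\sin\varphi(t) > 0$ for all $t$.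
   Context: The unknowns $\theta,\varphi,p_\theta,p_\varphi$ are real-valued functions of $t$, and the system is considered where $\cos\theta\neq 0$. Here $\dot h = \dot h(t) = \frac{2\pi a}{T}\cos\left(\frac{2\pi}{T}\frac{t}{\varepsilon}\right)$, and in the right-hand sides of the equations for $\dot p_\theta,\dot p_\varphi$ the symbols $\dot\theta,\dot\varphi$ stand for the expressions given by the first two equations, so this is a first-order system in $(\theta,\varphi,p_\theta,p_\varphi)$. Interpretation: these are the equations of motion of a unit mass point on a sphere of unit radius with position $x=\cos\theta\cos\varphi$, $y=h(t)+\cos\theta\sin\varphi$, $z=\sin\theta$, unit gravity directed along the negative $y$-axis, viscous friction with coefficient $\mu$ proportional to the velocity relative to the sphere, and horizontal force $(P_x,P_z)$. The condition $\cos\theta\sin\varphi>0$ means that the rod of the pendulum stays strictly above the horizontal plane through the pivot (non-falling). *)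

theory Defs
  imports "HOL-Analysis.Analysis" "HOL-Library.Periodic_Fun"
begin

definition C_infinity :: "(real \<Rightarrow> real) \<Rightarrow> bool" where
  "C_infinity f \<longleftrightarrow> (\<forall>n. (deriv ^^ n) f differentiable_on UNIV)"

definition pivot_height :: "real \<Rightarrow> real \<Rightarrow> real \<Rightarrow> real \<Rightarrow> real" where
  "pivot_height a T \<epsilon> t = a * \<epsilon> * sin (2 * pi / T * (t / \<epsilon>))"

lemma deriv_pivot_height:
  assumes "\<epsilon> \<noteq> 0"
  shows "deriv (pivot_height a T \<epsilon>) t = 2 * pi * a / T * cos (2 * pi / T * (t / \<epsilon>))"
proof (rule DERIV_imp_deriv)
  define c where "c = 2 * pi / T"
  have "((\<lambda>t. a * \<epsilon> * sin (c * (t / \<epsilon>))) has_real_derivative a * c * cos (c * (t / \<epsilon>))) (at t)"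
    using assms by (auto intro!: derivative_eq_intros)
  then show "(pivot_height a T \<epsilon> has_real_derivative
      2 * pi * a / T * cos (2 * pi / T * (t / \<epsilon>))) (at t)"
    by (simp add: pivot_height_def [abs_def] c_def mult.commute mult.left_commute)
qed

text \<open>
  Hamilton's equations of the pendulum. The argument \<open>dh\<close> is the velocity of the pivot at the
  given time, \<open>fx\<close> and \<open>fz\<close> are the values of the horizontal force at that time. The velocities
  occurring on the right-hand sides of the momentum equations are the expressions
  \<open>theta_rate\<close> and \<open>phi_rate\<close>, so the system is first order and explicit. It is meaningful where
  \<open>cos \<theta> \<noteq> 0\<close>.
\<close>

definition theta_rate :: "real \<Rightarrow> real \<Rightarrow> real \<Rightarrow> real \<Rightarrow> real" where
  "theta_rate dh \<theta> \<phi> p\<theta> = p\<theta> + dh * sin \<theta> * sin \<phi>"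

definition phi_rate :: "real \<Rightarrow> real \<Rightarrow> real \<Rightarrow> real \<Rightarrow> real" where
  "phi_rate dh \<theta> \<phi> p\<phi> = (p\<phi> - dh * cos \<theta> * cos \<phi>) / (cos \<theta>)\<^sup>2"

definition p_theta_rate ::
  "real \<Rightarrow> real \<Rightarrow> real \<Rightarrow> real \<Rightarrow> real \<Rightarrow> real \<Rightarrow> real \<Rightarrow> real \<Rightarrow> real" where
  "p_theta_rate \<mu> fx fz dh \<theta> \<phi> p\<theta> p\<phi> =
    (let d\<theta> = theta_rate dh \<theta> \<phi> p\<theta>; d\<phi> = phi_rate dh \<theta> \<phi> p\<phi> in
      - d\<phi>\<^sup>2 * cos \<theta> * sin \<theta> - dh * d\<theta> * cos \<theta> * sin \<phi> - dh * d\<phi> * sin \<theta> * cos \<phi>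
      - \<mu> * d\<theta> + sin \<theta> * sin \<phi> - fx * sin \<theta> * cos \<phi> + fz * cos \<theta>)"

definition p_phi_rate ::
  "real \<Rightarrow> real \<Rightarrow> real \<Rightarrow> real \<Rightarrow> real \<Rightarrow> real \<Rightarrow> real \<Rightarrow> real" where
  "p_phi_rate \<mu> fx dh \<theta> \<phi> p\<theta> p\<phi> =
    (let d\<theta> = theta_rate dh \<theta> \<phi> p\<theta>; d\<phi> = phi_rate dh \<theta> \<phi> p\<phi> in
      - dh * d\<theta> * sin \<theta> * cos \<phi> - dh * d\<phi> * cos \<theta> * sin \<phi> - cos \<theta> * cos \<phi>
      - \<mu> * d\<phi> * (cos \<theta>)\<^sup>2 - fx * cos \<theta> * sin \<phi>)"

text \<open>A solution defined on the whole real line, for the pivot motion \<open>h\<close>.\<close>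

definition pendulum_solution ::
  "real \<Rightarrow> (real \<Rightarrow> real) \<Rightarrow> (real \<Rightarrow> real) \<Rightarrow> (real \<Rightarrow> real) \<Rightarrow>
   (real \<Rightarrow> real) \<Rightarrow> (real \<Rightarrow> real) \<Rightarrow> (real \<Rightarrow> real) \<Rightarrow> (real \<Rightarrow> real) \<Rightarrow> bool" where
  "pendulum_solution \<mu> Px Pz h \<theta> \<phi> p\<theta> p\<phi> \<longleftrightarrow> (\<forall>t.
     cos (\<theta> t) \<noteq> 0 \<and>
     (\<theta> has_real_derivative theta_rate (deriv h t) (\<theta> t) (\<phi> t) (p\<theta> t)) (at t) \<and>
     (\<phi> has_real_derivative phi_rate (deriv h t) (\<theta> t) (\<phi> t) (p\<phi> t)) (at t) \<and>
     (p\<theta> has_real_derivative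
        p_theta_rate \<mu> (Px t) (Pz t) (deriv h t) (\<theta> t) (\<phi> t) (p\<theta> t) (p\<phi> t)) (at t) \<and>
     (p\<phi> has_real_derivative
        p_phi_rate \<mu> (Px t) (deriv h t) (\<theta> t) (\<phi> t) (p\<theta> t) (p\<phi> t)) (at t))"

end

theory Submission
  imports Defs "HOL-Complex_Analysis.Great_Picard"
begin

text \<open>
  In stereographic coordinates \<open>q\<close> from the south pole the hemisphere above the horizontal plane is
  the disc \<open>\<bar>q\<bar> < 1\<close>. With the momentum \<open>w\<close> taken with respect to an orthonormal frame, the equations
  of motion are quadratic in the velocity \<open>\<eta>\<close> of the pivot and do not involve its acceleration.
  Truncating them outside a compact set turns them into the saddle \<open>q' = w\<close>, \<open>w' = q\<close> with a bounded
  perturbation, which has a periodic solution: the period maps of its Euler schemes have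
  fixed points by Brouwer's theorem, and these converge by Arzela--Ascoli. As \<open>k \<rightarrow> \<infinity>\<close> the periodic
  solutions for \<open>\<epsilon> = 1/k\<close> accumulate at a periodic solution of the averaged system, in which \<open>\<eta>\<close> is
  replaced by \<open>0\<close> and \<open>\<eta>\<^sup>2\<close> by its mean. For the averaged system a maximum principle applies. Near the
  horizon the averaged force points outwards, since the effect of the vibration vanishes there and
  the external force is horizontal; hence \<open>\<bar>q\<bar>\<close> cannot have its maximum near or beyond \<open>1\<close>. Friction then
  bounds \<open>\<bar>w\<bar>\<close>. So for large \<open>k\<close> the periodic solutions stay where nothing was truncated.
\<close>

section \<open>Limits of approximate periodic solutions\<close>

text \<open>No sign condition at the horizon holds for the vibrating system itself: the acceleration
  of the pivot is tangential there, of order \<open>1 / \<epsilon>\<close>, and changes sign; in the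
  chart the vibration contributes the radial term \<eta> q to \<open>q'\<close>. Only the averaged
  system pushes outwards. Its periodic solutions, however, may be degenerate, so none of them can
  simply be continued to small \<epsilon>. Hence the order of the argument: existence first, for
  every \<open>k\<close>, with bounds independent of \<open>k\<close>; then a priori bounds for all
  periodic solutions of the averaged system, which solutions close to them inherit up to a small
  error.

  The saddle comes from gravity. In the chosen frame its tangential part is
  \<open>q / s = q + y * q\<close>; the summand \<open>q\<close> is left untruncated, while all
  remaining terms are bounded once \<open>q\<close> and \<open>w\<close> are clipped. Clipping is
  radial, so it keeps directions and with them the signs on which the maximum principle rests.

  Uniformity in \<open>k\<close> is possible because the velocity of the pivot has amplitude
  \<open>2 * pi * a / T\<close> whatever \<epsilon> is; only its frequency grows.\<close>

lemma periodic_extension_has_vector_derivative: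
  fixes g :: "real \<Rightarrow> 'b::real_normed_vector" and F :: "real \<Rightarrow> 'b \<Rightarrow> 'b"
  assumes "T > 0"
    and gT: "\<And>t. t \<in> {0..T} \<Longrightarrow> g (t + T) = g t"
    and FT: "\<And>t x. F (t + T) x = F t x"
    and deriv: "\<And>t. t \<in> {0<..<2*T} \<Longrightarrow> (g has_vector_derivative F t (g t)) (at t)"
  obtains X where "\<And>t. X (t + T) = X t" "\<And>t. (X has_vector_derivative F t (X t)) (at t)"
    "\<And>t. t \<in> {0..T} \<Longrightarrow> X t = g t"
proof
  \<comment> \<open>Representatives in \<open>[T/2, 3T/2)\<close>, which lies in the interior of the domain of \<open>g\<close>, so that only
    two-sided derivatives occur.\<close>
  define n where "n t = \<lfloor>t / T - 1/2\<rfloor>" for t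
  define X where "X t = g (t - T * n t)" for t
  have nb: "T/2 \<le> t - T * n t \<and> t - T * n t < 3*T/2" for t
  proof -
    have "n t \<le> t / T - 1/2" "t / T - 1/2 < n t + 1"
      unfolding n_def by linarith+
    then have "T * n t \<le> T * (t / T - 1/2)" "T * (t / T - 1/2) < T * (n t + 1)"
      using \<open>T > 0\<close> by (auto intro: mult_left_mono mult_strict_left_mono)
    then show ?thesis using \<open>T > 0\<close> by (auto simp: algebra_simps)
  qed
  have FTint: "F (t - T * of_int m) x = F t x" for t x and m :: int
  proof -
    interpret periodic_fun_simple "\<lambda>t. F t x" T by unfold_locales (rule FT)
    show ?thesis using minus_of_int[of t m] by (simp add: mult.commute)
  qed
  have Xg: "X t = g (t - T * of_int m)" if "0 \<le> t - T * of_int m" "t - T * of_int m \<le> 2*T" for t and m :: int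
  proof -
    have "T * of_int (m - n t) < T * 2" "T * of_int (n t - m) < T * 2"
      using nb[of t] that \<open>T > 0\<close> by (auto simp: algebra_simps)
    then have "real_of_int (m - n t) < 2" "real_of_int (n t - m) < 2"
      using \<open>T > 0\<close> by (auto simp only: mult_less_cancel_left_pos)
    then have "m = n t \<or> m = n t + 1 \<or> m = n t - 1" by linarith
    moreover have "g (t - T * n t) = g (t - T * m)" if m: "m = n t + 1"
    proof -
      have *: "t - T * n t = (t - T * m) + T" using m by (simp add: algebra_simps)
      show ?thesis unfolding * by (rule gT) (use * nb[of t] that \<open>T > 0\<close> \<open>0 \<le> t - T * of_int m\<close> in auto)
    qed
    moreover have "g (t - T * n t) = g (t - T * m)" if m: "m = n t - 1"
    proof -
      have *: "t - T * m = (t - T * n t) + T" unfolding m by (simp add: algebra_simps)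
      show ?thesis unfolding * by (rule gT[symmetric]) (use * nb[of t] \<open>T > 0\<close> \<open>t - T * of_int m \<le> 2*T\<close> in auto)
    qed
    ultimately show ?thesis unfolding X_def by auto
  qed
  show "X (t + T) = X t" for t
  proof -
    have "(t + T) / T = t / T + 1" using \<open>T > 0\<close> by (simp add: field_simps)
    then have "n (t + T) = n t + 1" unfolding n_def by linarith
    then show ?thesis by (simp add: X_def algebra_simps)
  qed
  show "X t = g t" if "t \<in> {0..T}" for t
    using Xg[of t 0] that by simp
  show "(X has_vector_derivative F t (X t)) (at t)" for t
  proof -
    let ?c = "T * n t"
    have "(g has_vector_derivative F (t - ?c) (g (t - ?c))) (at (t - ?c))"
      by (rule deriv) (use nb[of t] \<open>T > 0\<close> in auto)
    then have "(g \<circ> (\<lambda>s. s - ?c) has_vector_derivative (1::real) *\<^sub>R F (t - ?c) (g (t - ?c))) (at t)"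
      by (intro vector_diff_chain_at) (auto intro!: derivative_eq_intros)
    then have "((\<lambda>s. g (s - ?c)) has_vector_derivative F t (X t)) (at t)"
      by (simp add: o_def FTint X_def)
    then show ?thesis
    proof (rule has_vector_derivative_transform_within_open[where S="{t - T/2<..<t + T/2}"])
      fix s assume "s \<in> {t - T/2<..<t + T/2}"
      then show "g (s - ?c) = X s"
        using Xg[of s "n t"] nb[of t] by auto
    qed (use \<open>T > 0\<close> in auto)
  qed
qed

text \<open>The approximants have to satisfy the equation only in integrated form and up to an error
  tending to 0. This covers both applications: Euler polygons, whose velocity is frozen on each
  step, and fast vibrating solutions, whose oscillating terms integrate to almost nothing. Two
  periods are used so that every time has, modulo \<open>T\<close>, a representative in the
  interior.\<close>

lemma periodic_solution_of_approximations:
  fixes x :: "nat \<Rightarrow> real \<Rightarrow> 'b::euclidean_space" and F :: "real \<Rightarrow> 'b \<Rightarrow> 'b"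
  assumes "T > 0"
    and FT: "\<And>t x. F (t + T) x = F t x"
    and cont: "continuous_on UNIV (\<lambda>(t, x). F t x)"
    and bound: "\<And>n t. t \<in> {0..2*T} \<Longrightarrow> norm (x n t) \<le> B"
    and lip: "\<And>n s t. s \<in> {0..2*T} \<Longrightarrow> t \<in> {0..2*T} \<Longrightarrow> norm (x n s - x n t) \<le> L * \<bar>s - t\<bar>"
    and xT: "\<And>n t. t \<in> {0..T} \<Longrightarrow> x n (t + T) = x n t"
    and resid: "\<And>t. t \<in> {0..2*T} \<Longrightarrow>
      (\<lambda>n. x n t - x n 0 - integral {0..t} (\<lambda>s. F s (x n s))) \<longlonglongrightarrow> 0"
  obtains X r where "strict_mono (r :: nat \<Rightarrow> nat)" "\<And>t. X (t + T) = X t"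
    "\<And>t. (X has_vector_derivative F t (X t)) (at t)"
    "uniform_limit {0..T} (\<lambda>n. x (r n)) X sequentially"
proof -
  let ?S = "{0..2*T}"
  obtain g and r :: "nat \<Rightarrow> nat" where contg: "continuous_on ?S g" and r: "strict_mono r"
    and conv: "\<And>e. 0 < e \<Longrightarrow> \<exists>N. \<forall>n t. n \<ge> N \<and> t \<in> ?S \<longrightarrow> norm (x (r n) t - g t) < e"
  proof (rule Arzela_Ascoli[of ?S x B])
    fix t :: real and e :: real assume "t \<in> ?S" "0 < e"
    show "\<exists>d. 0 < d \<and> (\<forall>n s. s \<in> ?S \<and> norm (t - s) < d \<longrightarrow> norm (x n t - x n s) < e)"
    proof (intro exI[of _ "e / (\<bar>L\<bar> + 1)"] conjI allI impI)
      fix n s assume "s \<in> ?S \<and> norm (t - s) < e / (\<bar>L\<bar> + 1)"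
      then have s: "s \<in> ?S" and ts: "\<bar>t - s\<bar> * (\<bar>L\<bar> + 1) < e" by (auto simp: field_simps)
      have "norm (x n t - x n s) \<le> L * \<bar>t - s\<bar>" using lip \<open>t \<in> ?S\<close> s by auto
      also have "\<dots> \<le> (\<bar>L\<bar> + 1) * \<bar>t - s\<bar>" by (intro mult_right_mono) auto
      finally show "norm (x n t - x n s) < e" using ts by (simp add: mult.commute)
    qed (use \<open>0 < e\<close> in auto)
  qed (use bound in auto)
  have ul: "uniform_limit ?S (\<lambda>n. x (r n)) g sequentially"
    unfolding uniform_limit_sequentially_iff dist_norm using conv by blast
  have lim: "(\<lambda>n. x (r n) t) \<longlonglongrightarrow> g t" if "t \<in> ?S" for t
    by (rule tendsto_uniform_limitI[OF ul that])
  have contx: "continuous_on ?S (x n)" for n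
  proof (rule lipschitz_on_continuous_on)
    show "\<bar>L\<bar>-lipschitz_on ?S (x n)"
    proof (rule lipschitz_onI)
      fix s t assume "s \<in> ?S" "t \<in> ?S"
      then have "norm (x n s - x n t) \<le> L * \<bar>s - t\<bar>" by (rule lip)
      also have "\<dots> \<le> \<bar>L\<bar> * \<bar>s - t\<bar>" by (intro mult_right_mono) auto
      finally show "dist (x n s) (x n t) \<le> \<bar>L\<bar> * dist s t" by (simp add: dist_norm)
    qed simp
  qed
  have contF: "continuous_on A (\<lambda>s. F s (y s))" if "continuous_on A y" for A y
    using continuous_on_compose2[OF cont, of A "\<lambda>s. (s, y s)"] that
    by (simp add: continuous_on_Pair)
  have inB: "x n t \<in> cball 0 B" if "t \<in> ?S" for n t using bound[OF that] by simp
  have gB: "g t \<in> cball 0 B" if "t \<in> ?S" for t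
    using closed_sequentially[OF closed_cball _ lim[OF that]] inB[OF that] by blast
  have ulF: "uniform_limit ?S (\<lambda>n s. F s (x (r n) s)) (\<lambda>s. F s (g s)) sequentially"
  proof -
    have "uniformly_continuous_on (?S \<times> cball 0 B) (\<lambda>(t, x). F t x)"
      by (intro compact_uniformly_continuous compact_Times continuous_on_subset[OF cont]) auto
    moreover have "uniform_limit ?S (\<lambda>n s. (s, x (r n) s)) (\<lambda>s. (s, g s)) sequentially"
      using ul unfolding uniform_limit_sequentially_iff dist_Pair_Pair by simp
    moreover have "\<forall>\<^sub>F n in sequentially. \<forall>s\<in>?S. (s, x (r n) s) \<in> ?S \<times> cball 0 B"
      using inB by (intro always_eventually) blast
    moreover have "closed (?S \<times> cball 0 B)" by (intro closed_Times) auto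
    ultimately have "uniform_limit ?S (\<lambda>n s. (\<lambda>(t, x). F t x) (s, x (r n) s)) (\<lambda>s. (\<lambda>(t, x). F t x) (s, g s)) sequentially"
      using uniform_limit_compose_uniformly_continuous_on by blast
    then show ?thesis by simp
  qed
  have geq: "g t = g 0 + integral {0..t} (\<lambda>s. F s (g s))" if t: "t \<in> ?S" for t
  proof -
    have sub: "{0..t} \<subseteq> ?S" using t by auto
    obtain I J where "\<And>n. ((\<lambda>s. F s (x (r n) s)) has_integral I n) {0..t}"
      "((\<lambda>s. F s (g s)) has_integral J) {0..t}" "I \<longlonglongrightarrow> J"
    proof (rule uniform_limit_integral)
      show "uniform_limit {0..t} (\<lambda>n s. F s (x (r n) s)) (\<lambda>s. F s (g s)) sequentially"
        by (rule uniform_limit_on_subset[OF ulF sub])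
    qed (auto intro!: contF continuous_on_subset[OF contx sub])
    moreover from this have "(\<lambda>n. integral {0..t} (\<lambda>s. F s (x (r n) s))) = I"
      "integral {0..t} (\<lambda>s. F s (g s)) = J"
      by (auto intro!: ext integral_unique)
    ultimately have "(\<lambda>n. integral {0..t} (\<lambda>s. F s (x (r n) s))) \<longlonglongrightarrow> integral {0..t} (\<lambda>s. F s (g s))"
      by simp
    then have "(\<lambda>n. x (r n) t - x (r n) 0 - integral {0..t} (\<lambda>s. F s (x (r n) s)))
        \<longlonglongrightarrow> g t - g 0 - integral {0..t} (\<lambda>s. F s (g s))"
      using t \<open>T > 0\<close> by (intro tendsto_diff lim) auto
    moreover have "(\<lambda>n. x (r n) t - x (r n) 0 - integral {0..t} (\<lambda>s. F s (x (r n) s))) \<longlonglongrightarrow> 0"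
      using LIMSEQ_subseq_LIMSEQ[OF resid[OF t] r] by (simp add: o_def)
    ultimately have "g t - g 0 - integral {0..t} (\<lambda>s. F s (g s)) = 0"
      using LIMSEQ_unique by blast
    then show ?thesis by (simp add: algebra_simps)
  qed
  have deriv: "(g has_vector_derivative F t (g t)) (at t)" if t: "t \<in> {0<..<2*T}" for t
  proof -
    have "((\<lambda>u. integral {0..u} (\<lambda>s. F s (g s))) has_vector_derivative F t (g t)) (at t within ?S)"
      using t by (intro integral_has_vector_derivative contF contg) auto
    then have "((\<lambda>u. g 0 + integral {0..u} (\<lambda>s. F s (g s))) has_vector_derivative F t (g t)) (at t within ?S)"
      by (auto intro!: derivative_eq_intros)
    moreover have "at t within ?S = at t"
      using t by (intro at_within_interior) auto
    ultimately have "((\<lambda>u. g 0 + integral {0..u} (\<lambda>s. F s (g s))) has_vector_derivative F t (g t)) (at t)"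
      by simp
    then show ?thesis
    proof (rule has_vector_derivative_transform_within_open[where S="{0<..<2*T}"])
      fix u assume "u \<in> {0<..<2*T}"
      then show "g 0 + integral {0..u} (\<lambda>s. F s (g s)) = g u" by (intro geq[symmetric]) auto
    qed (use t in auto)
  qed
  have gT: "g (t + T) = g t" if "t \<in> {0..T}" for t
  proof (rule LIMSEQ_unique)
    show "(\<lambda>n. x (r n) (t + T)) \<longlonglongrightarrow> g (t + T)" using that by (intro lim) auto
    show "(\<lambda>n. x (r n) (t + T)) \<longlonglongrightarrow> g t"
      using lim[of t] that \<open>T > 0\<close> xT[OF that] by simp
  qed
  obtain X where X: "\<And>t. X (t + T) = X t" "\<And>t. (X has_vector_derivative F t (X t)) (at t)"
    and Xg: "\<And>t. t \<in> {0..T} \<Longrightarrow> X t = g t"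
    using periodic_extension_has_vector_derivative[of T g F] \<open>T > 0\<close> gT FT deriv by blast
  have "uniform_limit {0..T} (\<lambda>n. x (r n)) g sequentially"
    by (rule uniform_limit_on_subset[OF ul]) (use \<open>T > 0\<close> in auto)
  then have "uniform_limit {0..T} (\<lambda>n. x (r n)) X sequentially"
    unfolding uniform_limit_iff by (simp add: Xg)
  then show thesis by (rule that[OF r X])
qed

section \<open>Euler polygons\<close>

primrec euler :: "(real \<Rightarrow> 'b::real_vector \<Rightarrow> 'b) \<Rightarrow> real \<Rightarrow> 'b \<Rightarrow> nat \<Rightarrow> 'b" where
  "euler F h x0 0 = x0"
| "euler F h x0 (Suc j) = euler F h x0 j + h *\<^sub>R F (real j * h) (euler F h x0 j)"

text \<open>The coefficient of the \<open>i\<close>-th velocity is the time spent in step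
  \<open>i\<close> up to time \<open>t\<close>. A sum that never selects the current step gives a
  function on the whole line, constant outside the \<open>m\<close> steps.\<close>

definition polygon :: "(real \<Rightarrow> 'b::real_vector \<Rightarrow> 'b) \<Rightarrow> real \<Rightarrow> 'b \<Rightarrow> nat \<Rightarrow> real \<Rightarrow> 'b" where
  "polygon F h x0 m t =
    x0 + (\<Sum>i<m. max 0 (min (t - real i * h) h) *\<^sub>R F (real i * h) (euler F h x0 i))"

lemma euler_eq_sum: "euler F h x0 j = x0 + (\<Sum>i<j. h *\<^sub>R F (real i * h) (euler F h x0 i))"
  by (induction j) (auto simp: algebra_simps)

lemma continuous_on_euler:
  fixes F :: "real \<Rightarrow> 'b::real_normed_vector \<Rightarrow> 'b"
  assumes "\<And>t. continuous_on UNIV (F t)"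
  shows "continuous_on UNIV (\<lambda>x0. euler F h x0 j)"
proof (induction j)
  case (Suc j)
  then show ?case
    by (auto intro!: continuous_intros continuous_on_compose2[OF assms Suc])
qed (auto intro!: continuous_intros)

lemma euler_periodic:
  assumes per: "euler F h x0 N = x0" and FT: "\<And>t x. F (t + real N * h) x = F t x"
  shows "euler F h x0 (j + N) = euler F h x0 j"
proof (induction j)
  case (Suc j)
  have "F (real (j + N) * h) x = F (real j * h) x" for x
    using FT[of "real j * h" x] by (simp add: algebra_simps)
  with Suc show ?case by simp
qed (use per in simp)

lemma polygon_eq:
  assumes "j < m" "h > 0" and t: "real j * h \<le> t" "t \<le> real (Suc j) * h"
  shows "polygon F h x0 m t = euler F h x0 j + (t - real j * h) *\<^sub>R F (real j * h) (euler F h x0 j)"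
proof -
  let ?V = "\<lambda>i. F (real i * h) (euler F h x0 i)" and ?c = "\<lambda>i. max 0 (min (t - real i * h) h)"
  have c_before: "?c i = h" if "i < j" for i
  proof -
    have "real (Suc i) * h \<le> real j * h" using \<open>h > 0\<close> that by (intro mult_right_mono) auto
    then have "h \<le> t - real i * h" using t by (simp add: algebra_simps)
    then show ?thesis using \<open>h > 0\<close> by simp
  qed
  have c_at: "?c j = t - real j * h"
  proof -
    have "t - real j * h \<le> h" using t by (simp add: algebra_simps)
    then show ?thesis using t by simp
  qed
  have c_after: "?c i = 0" if "j < i" for i
  proof -
    have "real (Suc j) * h \<le> real i * h" using \<open>h > 0\<close> that by (intro mult_right_mono) auto
    then have "t - real i * h \<le> 0" using t by simp
    then show ?thesis using \<open>h > 0\<close> by simp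
  qed
  have "(\<Sum>i<m. ?c i *\<^sub>R ?V i) = (\<Sum>i<Suc j. ?c i *\<^sub>R ?V i)"
  proof (rule sum.mono_neutral_right)
    show "\<forall>i\<in>{..<m} - {..<Suc j}. ?c i *\<^sub>R ?V i = 0"
    proof
      fix i assume "i \<in> {..<m} - {..<Suc j}"
      then have "?c i = 0" by (intro c_after) auto
      then show "?c i *\<^sub>R ?V i = 0" by (simp only: scaleR_zero_left)
    qed
  qed (use \<open>j < m\<close> in auto)
  then have "(\<Sum>i<m. ?c i *\<^sub>R ?V i) = (\<Sum>i<j. ?c i *\<^sub>R ?V i) + ?c j *\<^sub>R ?V j"
    by (simp only: sum.lessThan_Suc)
  moreover have "(\<Sum>i<j. ?c i *\<^sub>R ?V i) = (\<Sum>i<j. h *\<^sub>R ?V i)"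
  proof (rule sum.cong[OF refl])
    fix i assume "i \<in> {..<j}"
    then have "?c i = h" by (intro c_before) auto
    then show "?c i *\<^sub>R ?V i = h *\<^sub>R ?V i" by (simp only:)
  qed
  ultimately show ?thesis
    unfolding polygon_def c_at using euler_eq_sum[of F h x0 j] by (simp only: add.assoc)
qed

lemma polygon_lipschitz:
  fixes F :: "real \<Rightarrow> 'b::real_normed_vector \<Rightarrow> 'b"
  assumes "h > 0" and C: "\<And>i. i < m \<Longrightarrow> norm (F (real i * h) (euler F h x0 i)) \<le> C" "C \<ge> 0"
  shows "norm (polygon F h x0 m s - polygon F h x0 m t) \<le> C * \<bar>s - t\<bar>"
proof -
  let ?V = "\<lambda>i. F (real i * h) (euler F h x0 i)"
  define c where "c t i = max 0 (min (t - real i * h) h)" for t i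
  \<comment> \<open>The times spent in the first \<open>k\<close> steps add up to \<open>t\<close>
    clamped to the interval from 0 to \<open>k * h\<close>; hence their increments between two times
    sum to at most the elapsed time.\<close>
  have csum: "(\<Sum>i<k. c t i) = max 0 (min t (real k * h))" for t k
  proof (induction k)
    case (Suc k)
    have "max 0 (min t u) + max 0 (min (t - u) h) = max 0 (min t (u + h))" if "0 \<le> u" for u
      using \<open>h > 0\<close> that by (auto simp: max_def min_def)
    from this[of "real k * h"] have "max 0 (min t (real k * h)) + c t k = max 0 (min t (real k * h + h))"
      unfolding c_def using \<open>h > 0\<close> by simp
    then show ?case using Suc by (simp add: algebra_simps)
  qed simp
  have le: "norm (polygon F h x0 m t - polygon F h x0 m s) \<le> C * (t - s)" if "s \<le> t" for s t
  proof -
    have "polygon F h x0 m t - polygon F h x0 m s = (\<Sum>i<m. (c t i - c s i) *\<^sub>R ?V i)"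
      unfolding polygon_def c_def by (simp add: sum_subtractf scaleR_left_diff_distrib)
    also have "norm \<dots> \<le> (\<Sum>i<m. (c t i - c s i) * C)"
    proof (rule sum_norm_le)
      fix i assume "i \<in> {..<m}"
      have "c s i \<le> c t i" unfolding c_def using that by auto
      then show "norm ((c t i - c s i) *\<^sub>R ?V i) \<le> (c t i - c s i) * C"
        using C(1)[of i] \<open>i \<in> {..<m}\<close> by (auto intro!: mult_left_mono)
    qed
    also have "\<dots> = (max 0 (min t (real m * h)) - max 0 (min s (real m * h))) * C"
      by (simp add: sum_distrib_right[symmetric] sum_subtractf csum)
    also have "\<dots> \<le> (t - s) * C"
      using \<open>C \<ge> 0\<close> that by (intro mult_right_mono) auto
    finally show ?thesis by (simp add: mult.commute)
  qed
  show ?thesis using le[of s t] le[of t s] by (cases "s \<le> t") (auto simp: norm_minus_commute)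
qed

text \<open>The polygon integrates exactly the velocity frozen at the last node, so its defect in
  the integral equation grows at rate at most \<delta>. The estimate is carried from node to node
  and then into the current step.\<close>

lemma polygon_residual:
  fixes F :: "real \<Rightarrow> 'b::euclidean_space \<Rightarrow> 'b"
  assumes "h > 0" and cont: "continuous_on {0..real m * h} (\<lambda>s. F s (polygon F h x0 m s))"
    and \<delta>: "\<And>j s. j < m \<Longrightarrow> real j * h \<le> s \<Longrightarrow> s \<le> real (Suc j) * h \<Longrightarrow>
      norm (F (real j * h) (euler F h x0 j) - F s (polygon F h x0 m s)) \<le> \<delta>"
    and t: "0 \<le> t" "t \<le> real m * h"
  shows "norm (polygon F h x0 m t - x0 - integral {0..t} (\<lambda>s. F s (polygon F h x0 m s))) \<le> \<delta> * t"
proof -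
  let ?p = "polygon F h x0 m" and ?V = "\<lambda>i. F (real i * h) (euler F h x0 i)"
  let ?f = "\<lambda>s. F s (?p s)"
  have step: "norm (?p t - x0 - integral {0..t} ?f) \<le> \<delta> * t"
    if j: "j < m" and base: "norm (euler F h x0 j - x0 - integral {0..real j * h} ?f) \<le> \<delta> * (real j * h)"
      and t: "real j * h \<le> t" "t \<le> real (Suc j) * h" for j t
  proof -
    let ?u = "real j * h"
    have u0: "0 \<le> ?u" using \<open>h > 0\<close> by simp
    have "real (Suc j) * h \<le> real m * h" using j \<open>h > 0\<close> by (intro mult_right_mono) auto
    then have cont': "continuous_on {0..t} ?f"
      using t by (intro continuous_on_subset[OF cont]) auto
    then have int: "?f integrable_on {0..t}" by (rule integrable_continuous_interval)
    have int2: "?f integrable_on {?u..t}"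
      using u0 by (intro integrable_continuous_interval continuous_on_subset[OF cont']) auto
    have comb: "integral {0..t} ?f = integral {0..?u} ?f + integral {?u..t} ?f"
      using u0 t int by (intro Henstock_Kurzweil_Integration.integral_combine[symmetric]) auto
    have diff: "integral {?u..t} (\<lambda>s. ?V j - ?f s) = (t - ?u) *\<^sub>R ?V j - integral {?u..t} ?f"
      using t int2 by (subst Henstock_Kurzweil_Integration.integral_diff) auto
    have eq: "?p t - x0 - integral {0..t} ?f =
        (euler F h x0 j - x0 - integral {0..?u} ?f) + integral {?u..t} (\<lambda>s. ?V j - ?f s)"
      unfolding comb diff polygon_eq[OF j \<open>h > 0\<close> t, of F x0] by simp
    have "norm (integral {?u..t} (\<lambda>s. ?V j - ?f s)) \<le> integral {?u..t} (\<lambda>s. \<delta>)"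
      using t int2 by (intro integral_norm_bound_integral integrable_diff \<delta>[OF j]) auto
    also have "\<dots> = \<delta> * (t - ?u)" using t by (simp add: mult.commute)
    finally show ?thesis
      unfolding eq using base norm_triangle_ineq[of "euler F h x0 j - x0 - integral {0..?u} ?f"
          "integral {?u..t} (\<lambda>s. ?V j - ?f s)"] by (simp add: algebra_simps)
  qed
  have nodes: "norm (euler F h x0 j - x0 - integral {0..real j * h} ?f) \<le> \<delta> * (real j * h)"
    if "j \<le> m" for j
    using that
  proof (induction j)
    case (Suc j)
    then have j: "j < m" by simp
    have "?p (real (Suc j) * h) = euler F h x0 (Suc j)"
      using polygon_eq[OF j \<open>h > 0\<close>, of "real (Suc j) * h" F x0] \<open>h > 0\<close>
      by (auto simp: algebra_simps)
    then show ?case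
      using step[OF j Suc.IH, of "real (Suc j) * h"] j \<open>h > 0\<close> by (auto simp: algebra_simps)
  qed simp
  show ?thesis
  \<comment> \<open>At the right end the quotient \<open>t / h\<close> would select step
    \<open>m\<close>, which does not exist; the last step serves instead.\<close>
  proof (cases "t = real m * h")
    case True
    show ?thesis
    proof (cases m)
      case 0
      then show ?thesis using True by (simp add: polygon_def)
    next
      case (Suc j)
      then show ?thesis
        using step[of j t] nodes[of j] True \<open>h > 0\<close> by (auto simp: algebra_simps)
    qed
  next
    case False
    define j where "j = nat \<lfloor>t / h\<rfloor>"
    have "0 \<le> t / h" using t \<open>h > 0\<close> by simp
    then have "real j \<le> t / h" "t / h \<le> real (Suc j)"
      unfolding j_def by linarith+
    then have jt: "real j * h \<le> t" "t \<le> real (Suc j) * h" using \<open>h > 0\<close> by (auto simp: field_simps)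
    then have "real j * h < real m * h" using False t by linarith
    then have "j < m" using \<open>h > 0\<close> by simp
    then show ?thesis using step[OF \<open>j < m\<close> nodes jt] by simp
  qed
qed

section \<open>Bounded perturbations of a saddle\<close>

definition saddle_field :: "(real \<Rightarrow> 'a \<times> 'a \<Rightarrow> 'a::real_vector) \<Rightarrow> (real \<Rightarrow> 'a \<times> 'a \<Rightarrow> 'a) \<Rightarrow>
    real \<Rightarrow> 'a \<times> 'a \<Rightarrow> 'a \<times> 'a" where
  "saddle_field f g t x = (fst x + f t x, - snd x + g t x)"

text \<open>Discrete variation of constants: each step adds a perturbation of size at most
  \<open>h * G\<close>, which the remaining steps multiply by powers of \<open>1 + h\<close> or
  \<open>1 - h\<close>. The right-hand sides are the sums of these two geometric series.\<close>

lemma euler_saddle_field_bounds: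
  fixes f g :: "real \<Rightarrow> 'a::real_normed_vector \<times> 'a \<Rightarrow> 'a"
  assumes f: "\<And>t x. norm (f t x) \<le> G" and g: "\<And>t x. norm (g t x) \<le> G" and h: "0 < h" "h < 1"
  shows "norm (fst (euler (saddle_field f g) h x0 j) - (1 + h) ^ j *\<^sub>R fst x0) \<le> G * ((1 + h) ^ j - 1)"
    and "norm (snd (euler (saddle_field f g) h x0 j) - (1 - h) ^ j *\<^sub>R snd x0) \<le> G * (1 - (1 - h) ^ j)"
proof (induction j)
  let ?E = "euler (saddle_field f g) h x0"
  case (Suc j)
  have aux: "e + c *\<^sub>R e + h *\<^sub>R y - ((1 + c) * p) *\<^sub>R x = (1 + c) *\<^sub>R (e - p *\<^sub>R x) + h *\<^sub>R y"
    for e x y :: 'a and c p :: real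
    by (simp add: scaleR_left_distrib scaleR_right_diff_distrib distrib_right)
  have aux2: "e + h *\<^sub>R (y - e) - ((1 - h) * p) *\<^sub>R x = (1 - h) *\<^sub>R (e - p *\<^sub>R x) + h *\<^sub>R y"
    for e x y :: 'a and p :: real
    by (simp add: scaleR_left_diff_distrib scaleR_right_diff_distrib left_diff_distrib)
  { case 1
    have eq: "fst (?E (Suc j)) - (1 + h) ^ Suc j *\<^sub>R fst x0 =
        (1 + h) *\<^sub>R (fst (?E j) - (1 + h) ^ j *\<^sub>R fst x0) + h *\<^sub>R f (real j * h) (?E j)"
      using aux[of "fst (?E j)" h "f (real j * h) (?E j)" "(1 + h) ^ j" "fst x0"]
      by (simp add: saddle_field_def scaleR_right_distrib add.assoc)
    have "norm (fst (?E (Suc j)) - (1 + h) ^ Suc j *\<^sub>R fst x0) \<le>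
        norm ((1 + h) *\<^sub>R (fst (?E j) - (1 + h) ^ j *\<^sub>R fst x0)) + norm (h *\<^sub>R f (real j * h) (?E j))"
      unfolding eq by (rule norm_triangle_ineq)
    also have "\<dots> \<le> (1 + h) * (G * ((1 + h) ^ j - 1)) + h * G"
      unfolding norm_scaleR using h Suc.IH(1) f by (intro add_mono mult_mono) auto
    finally show ?case by (simp add: algebra_simps) }
  { case 2
    have eq: "snd (?E (Suc j)) - (1 - h) ^ Suc j *\<^sub>R snd x0 =
        (1 - h) *\<^sub>R (snd (?E j) - (1 - h) ^ j *\<^sub>R snd x0) + h *\<^sub>R g (real j * h) (?E j)"
      using aux2[of "snd (?E j)" "g (real j * h) (?E j)" "(1 - h) ^ j" "snd x0"]
      by (simp add: saddle_field_def)
    have "norm (snd (?E (Suc j)) - (1 - h) ^ Suc j *\<^sub>R snd x0) \<le>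
        norm ((1 - h) *\<^sub>R (snd (?E j) - (1 - h) ^ j *\<^sub>R snd x0)) + norm (h *\<^sub>R g (real j * h) (?E j))"
      unfolding eq by (rule norm_triangle_ineq)
    also have "\<dots> \<le> (1 - h) * (G * (1 - (1 - h) ^ j)) + h * G"
      unfolding norm_scaleR using h Suc.IH(2) g by (intro add_mono mult_mono) auto
    finally show ?case by (simp add: algebra_simps) }
qed auto

lemma euler_saddle_field_periodic:
  fixes f g :: "real \<Rightarrow> 'a::euclidean_space \<times> 'a \<Rightarrow> 'a"
  assumes f: "\<And>t x. norm (f t x) \<le> G" and g: "\<And>t x. norm (g t x) \<le> G" and h: "0 < h" "h < 1"
    and contf: "\<And>t. continuous_on UNIV (f t)" and contg: "\<And>t. continuous_on UNIV (g t)"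
    and "N > 0"
  obtains x0 where "euler (saddle_field f g) h x0 N = x0" "norm (fst x0) \<le> G" "norm (snd x0) \<le> G"
proof -
  let ?E = "\<lambda>x. euler (saddle_field f g) h x N"
  let ?A = "(1 + h) ^ N - 1" and ?B = "1 - (1 - h) ^ N"
  have A: "?A > 0" using h \<open>N > 0\<close> by (simp add: one_less_power)
  have B: "?B > 0" using h \<open>N > 0\<close> by (simp add: power_less_one_iff)
  \<comment> \<open>Solving \<open>?E x = x\<close> for the linear parts, whose factors
    \<open>(1 + h) ^ N\<close> and \<open>(1 - h) ^ N\<close> differ from 1, turns it into
    \<open>\<Phi> x = x\<close>. The deviation bounds hold for every \<open>x\<close> and are
    exactly \<open>G\<close> times the divisors, so \<Phi> maps the whole space into a product of
    balls whose radius depends neither on \<open>h\<close> nor on \<open>N\<close>.\<close>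
  define \<Phi> where "\<Phi> x = (- (fst (?E x) - (1 + h) ^ N *\<^sub>R fst x) /\<^sub>R ?A,
      (snd (?E x) - (1 - h) ^ N *\<^sub>R snd x) /\<^sub>R ?B)" for x
  have G: "G \<ge> 0" using order_trans[OF norm_ge_zero f] .
  obtain x where "x \<in> cball 0 G \<times> cball 0 G" "\<Phi> x = x"
  proof (rule brouwer[of "cball 0 G \<times> cball 0 G" \<Phi>])
    show "compact (cball (0::'a) G \<times> cball (0::'a) G)" by (intro compact_Times) auto
    show "convex (cball (0::'a) G \<times> cball (0::'a) G)" by (intro convex_Times) auto
    show "cball (0::'a) G \<times> cball (0::'a) G \<noteq> {}" using G by auto
    have "continuous_on UNIV (saddle_field f g t)" for t
      unfolding saddle_field_def [abs_def] by (intro continuous_intros contf contg)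
    then have "continuous_on UNIV ?E" by (rule continuous_on_euler)
    then show "continuous_on (cball 0 G \<times> cball 0 G) \<Phi>"
      unfolding \<Phi>_def by (intro continuous_intros) (auto intro: continuous_on_subset)
    show "\<Phi> \<in> cball 0 G \<times> cball 0 G \<rightarrow> cball 0 G \<times> cball 0 G"
    proof
      fix x :: "'a \<times> 'a"
      have scale: "norm (y /\<^sub>R c) \<le> G" if "norm y \<le> G * c" "c > 0" for y :: 'a and c
        using that by (simp add: field_simps)
      have "norm (fst (\<Phi> x)) \<le> G"
        unfolding \<Phi>_def fst_conv
        by (rule scale) (use euler_saddle_field_bounds(1)[where f=f and g=g, OF f g h, of x N] A in \<open>simp_all only: norm_minus_cancel\<close>)
      moreover have "norm (snd (\<Phi> x)) \<le> G"
        unfolding \<Phi>_def snd_conv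
        by (rule scale) (use euler_saddle_field_bounds(2)[where f=f and g=g, OF f g h, of x N] B in simp_all)
      ultimately show "\<Phi> x \<in> cball 0 G \<times> cball 0 G" by (simp add: mem_Times_iff)
    qed
  qed
  have fx: "fst x = - (fst (?E x) - (1 + h) ^ N *\<^sub>R fst x) /\<^sub>R ?A"
    using arg_cong[OF \<open>\<Phi> x = x\<close>, of fst] unfolding \<Phi>_def fst_conv by (rule sym)
  have sx: "snd x = (snd (?E x) - (1 - h) ^ N *\<^sub>R snd x) /\<^sub>R ?B"
    using arg_cong[OF \<open>\<Phi> x = x\<close>, of snd] unfolding \<Phi>_def snd_conv by (rule sym)
  have "?A *\<^sub>R fst x = - (fst (?E x) - (1 + h) ^ N *\<^sub>R fst x)"
    by (subst fx) (use A in \<open>simp only: scaleR_scaleR right_inverse[OF less_imp_neq[OF A, symmetric]] scaleR_one\<close>)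
  moreover have "?B *\<^sub>R snd x = (snd (?E x) - (1 - h) ^ N *\<^sub>R snd x)"
    by (subst sx) (use B in \<open>simp only: scaleR_scaleR right_inverse[OF less_imp_neq[OF B, symmetric]] scaleR_one\<close>)
  ultimately have "fst (?E x) = fst x" "snd (?E x) = snd x"
    by (simp_all add: scaleR_left_diff_distrib)
  then show thesis using \<open>x \<in> cball 0 G \<times> cball 0 G\<close> by (intro that[of x]) (auto simp: prod_eq_iff)
qed

lemma saddle_field_periodic_solution:
  fixes f g :: "real \<Rightarrow> 'a::euclidean_space \<times> 'a \<Rightarrow> 'a"
  assumes "T > 0"
    and f: "\<And>t x. norm (f t x) \<le> G" and g: "\<And>t x. norm (g t x) \<le> G"
    and contf: "continuous_on UNIV (\<lambda>(t, x). f t x)"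
    and contg: "continuous_on UNIV (\<lambda>(t, x). g t x)"
    and fT: "\<And>t x. f (t + T) x = f t x" and gT: "\<And>t x. g (t + T) x = g t x"
  obtains X where "\<And>t. X (t + T) = X t"
    "\<And>t. (X has_vector_derivative saddle_field f g t (X t)) (at t)"
proof -
  let ?F = "saddle_field f g"
  \<comment> \<open>The offset \<open>n0 > T\<close> makes every step size \<open>T / N n\<close>
    smaller than 1, as the Euler bounds require.\<close>
  obtain n0 :: nat where n0: "T < n0" using reals_Archimedean2 by blast
  define N where "N n = n + n0" for n
  define h where "h n = T / N n" for n
  have N: "N n > 0" for n using n0 \<open>T > 0\<close> by (auto simp: N_def intro: gr0I)
  have h: "0 < h n" "h n < 1" "N n * h n = T" for n
    using n0 \<open>T > 0\<close> N[of n] by (auto simp: h_def N_def field_simps)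
  have G: "G \<ge> 0" using order_trans[OF norm_ge_zero f] .
  have slice: "continuous_on UNIV (k t)" if "continuous_on UNIV (\<lambda>(t, x). k t x)"
    for k :: "real \<Rightarrow> 'a \<times> 'a \<Rightarrow> 'a" and t
    using continuous_on_compose2[OF that, of UNIV "\<lambda>x. (t, x)"]
    by (simp add: continuous_on_Pair)
  have "\<exists>x0. euler ?F (h n) x0 (N n) = x0 \<and> norm (fst x0) \<le> G \<and> norm (snd x0) \<le> G" for n
    by (rule euler_saddle_field_periodic[where f=f and g=g,
          OF f g h(1,2) slice[OF contf] slice[OF contg] N[of n]]) blast
  then obtain x0 where per: "\<And>n. euler ?F (h n) (x0 n) (N n) = x0 n"
    and x0: "\<And>n. norm (fst (x0 n)) \<le> G" "\<And>n. norm (snd (x0 n)) \<le> G" by metis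
  define E where "E n = euler ?F (h n) (x0 n)" for n
  define p where "p n = polygon ?F (h n) (x0 n) (2 * N n)" for n
  \<comment> \<open>A crude bound with exponential growth over two periods, good enough for
    compactness. A bound by \<open>G\<close>, free of \<open>T\<close>, is recovered afterwards for
    the periodic solution itself.\<close>
  define B where "B = G * (2 * exp (2 * T)) + 2 * G"
  have EB: "norm (fst (E n j)) \<le> G * (2 * exp (2 * T))" "norm (snd (E n j)) \<le> 2 * G" if "j \<le> 2 * N n" for n j
  proof -
    have "(1 + h n) ^ j \<le> exp (h n) ^ j" using h(1)[of n] by (intro power_mono) auto
    also have "\<dots> = exp (real j * h n)" by (simp add: exp_of_nat_mult)
    also have "\<dots> \<le> exp (2 * T)"
    proof -
      have "real j * h n \<le> real (2 * N n) * h n" using that h(1)[of n] by (intro mult_right_mono) auto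
      then show ?thesis using h(3)[of n] by simp
    qed
    finally have 1: "(1 + h n) ^ j \<le> exp (2 * T)" .
    have 2: "0 \<le> (1 - h n) ^ j" "(1 - h n) ^ j \<le> 1" using h[of n] by (auto intro: power_le_one)
    have 3: "1 \<le> (1 + h n) ^ j" using h(1)[of n] by (intro one_le_power) auto
    have "norm (fst (E n j)) \<le> norm (fst (E n j) - (1 + h n) ^ j *\<^sub>R fst (x0 n)) + norm ((1 + h n) ^ j *\<^sub>R fst (x0 n))"
      using norm_triangle_sub[of "fst (E n j)" "(1 + h n) ^ j *\<^sub>R fst (x0 n)"] by linarith
    also have "\<dots> \<le> G * ((1 + h n) ^ j - 1) + (1 + h n) ^ j * G"
      using euler_saddle_field_bounds(1)[where f=f and g=g, OF f g h(1,2), of n "x0 n" j] x0[of n] 3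
      by (intro add_mono) (auto simp: E_def intro!: mult_left_mono)
    also have "\<dots> \<le> G * (2 * (1 + h n) ^ j)" using G by (simp add: algebra_simps)
    also have "\<dots> \<le> G * (2 * exp (2 * T))" using 1 G by (intro mult_left_mono) auto
    finally show "norm (fst (E n j)) \<le> G * (2 * exp (2 * T))" .
    have "norm (snd (E n j)) \<le> norm (snd (E n j) - (1 - h n) ^ j *\<^sub>R snd (x0 n)) + norm ((1 - h n) ^ j *\<^sub>R snd (x0 n))"
      using norm_triangle_sub[of "snd (E n j)" "(1 - h n) ^ j *\<^sub>R snd (x0 n)"] by linarith
    also have "\<dots> \<le> G * (1 - (1 - h n) ^ j) + (1 - h n) ^ j * G"
      using euler_saddle_field_bounds(2)[where f=f and g=g, OF f g h(1,2), of n "x0 n" j] x0[of n] 2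
      by (intro add_mono) (auto simp: E_def intro!: mult_left_mono)
    also have "\<dots> \<le> 2 * G" using G by (simp add: algebra_simps)
    finally show "norm (snd (E n j)) \<le> 2 * G" .
  qed
  have FC: "norm (?F t x) \<le> norm (fst x) + norm (snd x) + 2 * G" for t x
  proof -
    have "norm (?F t x) \<le> norm (fst x + f t x) + norm (- snd x + g t x)"
      unfolding saddle_field_def by (rule norm_Pair_le)
    also have "\<dots> \<le> (norm (fst x) + norm (f t x)) + (norm (snd x) + norm (g t x))"
      by (intro add_mono norm_triangle_ineq order_trans[OF norm_triangle_ineq]) auto
    also have "\<dots> \<le> norm (fst x) + norm (snd x) + 2 * G" using f[of t x] g[of t x] by simp
    finally show ?thesis .
  qed
  define C where "C = B + 2 * G"
  have "B \<ge> 0" "C \<ge> 0" using G by (auto simp: B_def C_def)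
  have V: "norm (?F (real j * h n) (E n j)) \<le> C" if "j \<le> 2 * N n" for n j
    using FC[of "real j * h n" "E n j"] EB[OF that] by (simp add: B_def C_def)
  have EB': "norm (E n j) \<le> B" if "j \<le> 2 * N n" for n j
    using norm_Pair_le[of "fst (E n j)" "snd (E n j)"] EB[OF that] by (simp add: B_def)
  have contF: "continuous_on UNIV (\<lambda>(t, x). ?F t x)"
    using contf contg unfolding saddle_field_def case_prod_unfold
    by (intro continuous_intros) auto
  have FT: "?F (t + T) x = ?F t x" for t x by (simp add: saddle_field_def fT gT)
  have peq: "p n t = E n j + (t - real j * h n) *\<^sub>R ?F (real j * h n) (E n j)"
    if "j < 2 * N n" "real j * h n \<le> t" "t \<le> real (Suc j) * h n" for n j t
    unfolding p_def E_def by (rule polygon_eq) (use that h in auto)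
  have dist: "norm (p n t - E n j) \<le> C * h n"
    if "j < 2 * N n" "real j * h n \<le> t" "t \<le> real (Suc j) * h n" for n j t
  proof -
    have "norm (p n t - E n j) = (t - real j * h n) * norm (?F (real j * h n) (E n j))"
      using that by (simp add: peq[OF that])
    also have "\<dots> \<le> h n * C"
      using that V[of j n] h(1)[of n] by (intro mult_mono) (auto simp: algebra_simps)
    finally show ?thesis by (simp add: mult.commute)
  qed
  have node: "\<exists>j<k. real j * h n \<le> t \<and> t \<le> real (Suc j) * h n"
    if "t \<in> {0..real k * h n}" "k > 0" for n k t
  proof (cases "t = real k * h n")
    case True
    then show ?thesis using that h(1)[of n] by (intro exI[of _ "k - 1"]) (auto simp: of_nat_diff algebra_simps)
  next
    case False
    define j where "j = nat \<lfloor>t / h n\<rfloor>"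
    have "0 \<le> t / h n" using that h(1)[of n] by auto
    then have "real j \<le> t / h n" "t / h n \<le> real (Suc j)" unfolding j_def by linarith+
    then have jt: "real j * h n \<le> t" "t \<le> real (Suc j) * h n" using h(1)[of n] by (auto simp: field_simps)
    then have "real j * h n < real k * h n" using False that by auto
    then show ?thesis using jt h(1)[of n] by auto
  qed
  have twoT: "real (2 * N n) * h n = 2 * T" for n using h(3)[of n] by simp
  have pB: "norm (p n t) \<le> B + C" if t: "t \<in> {0..2*T}" for n t
  proof -
    obtain j where j: "j < 2 * N n" "real j * h n \<le> t" "t \<le> real (Suc j) * h n"
      using node[of t "2 * N n" n] t N[of n] unfolding twoT by auto
    have "norm (p n t) \<le> norm (p n t - E n j) + norm (E n j)"
      using norm_triangle_sub[of "p n t" "E n j"] by linarith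
    also have "\<dots> \<le> C * h n + B" using dist[OF j] EB'[of j n] j by (intro add_mono) auto
    also have "C * h n \<le> C * 1" using h[of n] \<open>C \<ge> 0\<close> by (intro mult_left_mono) auto
    finally show ?thesis by simp
  qed
  have plip: "norm (p n s - p n t) \<le> C * \<bar>s - t\<bar>" for n s t
    unfolding p_def by (rule polygon_lipschitz) (use h V \<open>C \<ge> 0\<close> in \<open>auto simp: E_def\<close>)
  have pT: "p n (t + T) = p n t" if t: "t \<in> {0..T}" for n t
  proof -
    obtain j where j: "j < N n" "real j * h n \<le> t" "t \<le> real (Suc j) * h n"
      using node[of t "N n" n] t N[of n] unfolding h(3) by auto
    have FTn: "?F (s + real (N n) * h n) x = ?F s x" for s x using FT h(3)[of n] by simp
    have EE: "E n (j + N n) = E n j"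
      unfolding E_def by (rule euler_periodic[OF per FTn])
    have shift: "real (j + N n) * h n = real j * h n + T"
      using h(3)[of n] by (simp add: algebra_simps)
    have "p n (t + T) = E n (j + N n) + (t + T - real (j + N n) * h n) *\<^sub>R ?F (real (j + N n) * h n) (E n (j + N n))"
      by (rule peq) (use j shift in \<open>auto simp: algebra_simps\<close>)
    also have "\<dots> = p n t"
      using peq[of j n t] j unfolding EE shift FT by simp
    finally show ?thesis .
  qed
  have contp: "continuous_on A (p n)" for n A
    by (rule lipschitz_on_continuous_on[of C], rule lipschitz_onI)
      (use plip \<open>C \<ge> 0\<close> in \<open>auto simp: dist_norm\<close>)
  have contFp: "continuous_on A (\<lambda>s. ?F s (p n s))" for A n
    using continuous_on_compose2[OF contF, of A "\<lambda>s. (s, p n s)"] contp[of A n]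
    by (simp add: continuous_on_Pair)
  have p0: "p n 0 = x0 n" for n
    using peq[of 0 n 0] N[of n] h(1)[of n] by (simp add: E_def)
  have hlim: "h \<longlonglongrightarrow> 0"
    unfolding h_def N_def using LIMSEQ_ignore_initial_segment[OF lim_const_over_n[of T], of n0] by simp
  obtain X where "\<And>t. X (t + T) = X t"
    "\<And>t. (X has_vector_derivative ?F t (X t)) (at t)"
  proof (rule periodic_solution_of_approximations[of T ?F p "B + C" C])
    fix t assume t: "t \<in> {0..2*T}"
    show "(\<lambda>n. p n t - p n 0 - integral {0..t} (\<lambda>s. ?F s (p n s))) \<longlonglongrightarrow> 0"
    proof (rule metric_LIMSEQ_I)
      fix e :: real assume "e > 0"
      define \<delta> where "\<delta> = e / (2 * T + 1)"
      have "\<delta> > 0" using \<open>e > 0\<close> \<open>T > 0\<close> by (simp add: \<delta>_def)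
      have "uniformly_continuous_on ({0..2*T} \<times> cball 0 (B + C)) (\<lambda>(t, x). ?F t x)"
        by (intro compact_uniformly_continuous compact_Times continuous_on_subset[OF contF]) auto
      then obtain d where "d > 0" and d: "\<And>s x s' x'. s \<in> {0..2*T} \<Longrightarrow> norm x \<le> B + C \<Longrightarrow> s' \<in> {0..2*T} \<Longrightarrow>
          norm x' \<le> B + C \<Longrightarrow> dist (s', x') (s, x) < d \<Longrightarrow> dist (?F s' x') (?F s x) < \<delta>"
        unfolding uniformly_continuous_on_def using \<open>\<delta> > 0\<close> by (auto 0 4)
      have "(\<lambda>n. h n + C * h n) \<longlonglongrightarrow> 0 + C * 0" by (intro tendsto_intros hlim)
      then have "(\<lambda>n. h n + C * h n) \<longlonglongrightarrow> 0" by simp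
      then have "\<forall>\<^sub>F n in sequentially. h n + C * h n < d" using \<open>d > 0\<close> by (rule order_tendstoD)
      then obtain n1 where n1: "\<And>n. n \<ge> n1 \<Longrightarrow> h n + C * h n < d"
        by (auto simp: eventually_sequentially)
      show "\<exists>no. \<forall>n\<ge>no. dist (p n t - p n 0 - integral {0..t} (\<lambda>s. ?F s (p n s))) 0 < e"
      proof (intro exI[of _ n1] allI impI)
        fix n assume "n \<ge> n1"
        have "norm (polygon ?F (h n) (x0 n) (2 * N n) t - x0 n -
            integral {0..t} (\<lambda>s. ?F s (polygon ?F (h n) (x0 n) (2 * N n) s))) \<le> \<delta> * t"
        proof (rule polygon_residual)
          fix j s assume j: "j < 2 * N n" and s: "real j * h n \<le> s" "s \<le> real (Suc j) * h n"
          have "real (Suc j) * h n \<le> real (2 * N n) * h n"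
            using j h(1)[of n] by (intro mult_right_mono) auto
          then have sT: "s \<le> 2 * T" using s(2) unfolding twoT by linarith
          have j0: "0 \<le> real j * h n" using h(1)[of n] by simp
          have "dist (real j * h n, E n j) (s, p n s) \<le> dist (real j * h n) s + dist (E n j) (p n s)"
            unfolding dist_Pair_Pair by (rule sqrt_sum_squares_le_sum) auto
          also have "\<dots> \<le> h n + C * h n"
            using s dist[OF j s] by (intro add_mono) (auto simp: dist_norm norm_minus_commute algebra_simps)
          also have "\<dots> < d" by (rule n1) fact
          finally have "dist (?F (real j * h n) (E n j)) (?F s (p n s)) < \<delta>"
            using sT s j0 EB'[of j n] j \<open>C \<ge> 0\<close> pB[of s n] by (intro d) auto
          then show "norm (?F (real j * h n) (euler ?F (h n) (x0 n) j) -
              ?F s (polygon ?F (h n) (x0 n) (2 * N n) s)) \<le> \<delta>"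
            by (simp add: dist_norm E_def p_def)
        next
          show "continuous_on {0..real (2 * N n) * h n}
              (\<lambda>s. ?F s (polygon ?F (h n) (x0 n) (2 * N n) s))"
            using contFp unfolding p_def .
          show "t \<le> real (2 * N n) * h n" unfolding twoT using t by simp
        qed (use t h in auto)
        also have "\<dots> < e"
        proof -
          have "\<delta> * t < \<delta> * (2 * T + 1)" using t \<open>\<delta> > 0\<close> by (intro mult_strict_left_mono) auto
          then show ?thesis using \<open>T > 0\<close> by (simp add: \<delta>_def)
        qed
        finally show "dist (p n t - p n 0 - integral {0..t} (\<lambda>s. ?F s (p n s))) 0 < e"
          unfolding p0 by (simp add: p_def)
      qed
    qed
  qed (use \<open>T > 0\<close> FT contF pB plip pT in auto)
  then show thesis by (rule that)
qed

section \<open>Maxima of periodic functions and the resulting a priori bounds\<close>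

lemma periodic_all:
  fixes T :: real
  assumes "T > 0" and per: "\<And>t. f (t + T) = f t" and "\<And>t. t \<in> {0..T} \<Longrightarrow> Q (f t)"
  shows "Q (f t)"
proof -
  interpret periodic_fun_simple f T by unfold_locales (rule per)
  have "t - of_int \<lfloor>t / T\<rfloor> * T \<in> {0..T}"
    using floor_divide_lower[OF \<open>T > 0\<close>, of t] floor_divide_upper[OF \<open>T > 0\<close>, of t]
    by (auto simp: algebra_simps)
  from assms(3)[OF this] show ?thesis by (simp only: minus_of_int)
qed

lemma periodic_attains_sup:
  fixes u :: "real \<Rightarrow> real"
  assumes "T > 0" and per: "\<And>t. u (t + T) = u t" and cont: "continuous_on UNIV u"
  obtains t0 where "\<And>t. u t \<le> u t0"
proof -
  have "\<exists>t0\<in>{0..T}. \<forall>t\<in>{0..T}. u t \<le> u t0"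
    by (rule continuous_attains_sup) (use \<open>T > 0\<close> continuous_on_subset[OF cont subset_UNIV] in auto)
  then obtain t0 where t0: "\<And>t. t \<in> {0..T} \<Longrightarrow> u t \<le> u t0" by blast
  have "u t \<le> u t0" for t
    by (rule periodic_all[of T u "\<lambda>y. y \<le> u t0"]) (use \<open>T > 0\<close> per t0 in auto)
  then show thesis by (rule that)
qed

lemma periodic_norm_critical:
  fixes x :: "real \<Rightarrow> 'a::real_inner"
  assumes "T > 0" and per: "\<And>t. x (t + T) = x t"
    and deriv: "\<And>t. (x has_vector_derivative x' t) (at t)"
  obtains t0 where "\<And>t. norm (x t) \<le> norm (x t0)" "inner (x t0) (x' t0) = 0"
proof -
  have D: "((\<lambda>t. inner (x t) (x t)) has_real_derivative 2 * inner (x t) (x' t)) (at t)" for t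
    using bounded_bilinear.has_vector_derivative[OF bounded_bilinear_inner deriv[of t] deriv[of t]]
    by (simp add: has_real_derivative_iff_has_vector_derivative inner_commute)
  have "continuous_on UNIV (\<lambda>t. inner (x t) (x t))"
    using D DERIV_isCont by (auto simp: continuous_on_eq_continuous_at)
  then obtain t0 where t0: "\<And>t. inner (x t) (x t) \<le> inner (x t0) (x t0)"
    using periodic_attains_sup[of T "\<lambda>t. inner (x t) (x t)"] \<open>T > 0\<close> per by auto
  have "2 * inner (x t0) (x' t0) = 0"
    by (rule DERIV_local_max[OF D zero_less_one]) (use t0 in auto)
  moreover have "norm (x t) \<le> norm (x t0)" for t using t0[of t] by (simp add: norm_le)
  ultimately show thesis using that by auto
qed

text \<open>At a maximum of its norm a component \<open>a\<close> is orthogonal to its derivative,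
  which is \<open>a\<close> or \<open>- a\<close> plus a perturbation; so \<open>|a|^2\<close> is at
  most \<open>|a| * G\<close>. The sign of the linear part is irrelevant, and the unstable direction
  costs nothing.\<close>

lemma saddle_field_periodic_bound:
  fixes f g :: "real \<Rightarrow> 'a::real_inner \<times> 'a \<Rightarrow> 'a"
  assumes "T > 0" and f: "\<And>t x. norm (f t x) \<le> G" and g: "\<And>t x. norm (g t x) \<le> G"
    and per: "\<And>t. Z (t + T) = Z t"
    and Z: "\<And>t. (Z has_vector_derivative saddle_field f g t (Z t)) (at t)"
  shows "norm (fst (Z t)) \<le> G" "norm (snd (Z t)) \<le> G"
proof -
  have bound: "norm a \<le> G" if "inner a (k *\<^sub>R a + y) = 0" "\<bar>k\<bar> = 1" "norm y \<le> G" for a y :: 'a and k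
  proof -
    have "norm a * norm a = \<bar>k * inner a a\<bar>" using that(2)
      by (simp add: abs_mult dot_square_norm power2_eq_square)
    also have "\<dots> = \<bar>inner a y\<bar>" using that(1) by (simp add: inner_add_right)
    also have "\<dots> \<le> norm a * norm y" by (rule Cauchy_Schwarz_ineq2)
    also have "\<dots> \<le> norm a * G" using that(3) by (intro mult_left_mono) auto
    finally show ?thesis using order_trans[OF norm_ge_zero that(3)]
      by (cases "a = 0") auto
  qed
  have "((\<lambda>t. fst (Z t)) has_vector_derivative 1 *\<^sub>R fst (Z t) + f t (Z t)) (at t)" for t
    using bounded_linear.has_vector_derivative[OF bounded_linear_fst Z] by (simp add: saddle_field_def)
  from periodic_norm_critical[OF \<open>T > 0\<close> _ this] obtain t0
    where t0: "\<And>t. norm (fst (Z t)) \<le> norm (fst (Z t0))"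
      "inner (fst (Z t0)) (1 *\<^sub>R fst (Z t0) + f t0 (Z t0)) = 0"
    using per by auto
  show "norm (fst (Z t)) \<le> G" by (rule order_trans[OF t0(1) bound[OF t0(2) _ f]]) simp
  have "((\<lambda>t. snd (Z t)) has_vector_derivative (- 1) *\<^sub>R snd (Z t) + g t (Z t)) (at t)" for t
    using bounded_linear.has_vector_derivative[OF bounded_linear_snd Z] by (simp add: saddle_field_def)
  from periodic_norm_critical[OF \<open>T > 0\<close> _ this] obtain t1
    where t1: "\<And>t. norm (snd (Z t)) \<le> norm (snd (Z t1))"
      "inner (snd (Z t1)) ((- 1) *\<^sub>R snd (Z t1) + g t1 (Z t1)) = 0"
    using per by auto
  show "norm (snd (Z t)) \<le> G" by (rule order_trans[OF t1(1) bound[OF t1(2) _ g]]) simp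
qed

corollary hyperbolic_periodic_solution:
  fixes f g :: "real \<Rightarrow> 'a::euclidean_space \<times> 'a \<Rightarrow> 'a"
  assumes "T > 0"
    and f: "\<And>t x. norm (f t x) \<le> G" and g: "\<And>t x. norm (g t x) \<le> G"
    and contf: "continuous_on UNIV (\<lambda>(t, x). f t x)"
    and contg: "continuous_on UNIV (\<lambda>(t, x). g t x)"
    and fT: "\<And>t x. f (t + T) x = f t x" and gT: "\<And>t x. g (t + T) x = g t x"
  obtains X where "\<And>t. X (t + T) = X t"
    "\<And>t. (X has_vector_derivative (snd (X t) + f t (X t), fst (X t) + g t (X t))) (at t)"
    "\<And>t. norm (fst (X t)) \<le> 2 * G" "\<And>t. norm (snd (X t)) \<le> 2 * G"
proof -
  \<comment> \<open>\<open>L\<close> diagonalizes the saddle: \<open>q + w\<close> is its unstable and \<open>w - q\<close> its stable coordinate.\<close>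
  define L :: "'a \<times> 'a \<Rightarrow> 'a \<times> 'a" where "L z = ((1/2) *\<^sub>R (fst z - snd z), (1/2) *\<^sub>R (fst z + snd z))" for z
  define u where "u t z = g t (L z) + f t (L z)" for t z
  define v where "v t z = g t (L z) - f t (L z)" for t z
  have contL: "continuous_on A (\<lambda>y. L (k y))" if "continuous_on A k" for A and k :: "real \<times> 'a \<times> 'a \<Rightarrow> 'a \<times> 'a"
    unfolding L_def by (intro continuous_intros that)
  have cf: "continuous_on UNIV (\<lambda>y. k (fst y) (L (snd y)))" if "continuous_on UNIV (\<lambda>(t, x). k t x)"
    for k :: "real \<Rightarrow> 'a \<times> 'a \<Rightarrow> 'a"
    using continuous_on_compose2[OF that, of UNIV "\<lambda>y. (fst y, L (snd y))"]
    by (simp add: contL continuous_on_Pair continuous_on_fst continuous_on_snd)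
  have u: "norm (u t z) \<le> 2 * G" for t z
    unfolding u_def using norm_triangle_ineq[of "g t (L z)" "f t (L z)"] f[of t "L z"] g[of t "L z"] by linarith
  have v: "norm (v t z) \<le> 2 * G" for t z
    unfolding v_def using norm_triangle_ineq4[of "g t (L z)" "f t (L z)"] f[of t "L z"] g[of t "L z"] by linarith
  obtain Z where ZT: "\<And>t. Z (t + T) = Z t"
    and Z: "\<And>t. (Z has_vector_derivative saddle_field u v t (Z t)) (at t)"
  proof (rule saddle_field_periodic_solution[of T u "2 * G" v])
    show "continuous_on UNIV (\<lambda>(t, x). u t x)" "continuous_on UNIV (\<lambda>(t, x). v t x)"
      unfolding u_def v_def case_prod_unfold by (intro continuous_intros cf contf contg)+
    show "u (t + T) z = u t z" "v (t + T) z = v t z" for t z by (simp_all add: u_def v_def fT gT)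
  qed (use \<open>T > 0\<close> u v in auto)
  note bound = saddle_field_periodic_bound[where f=u and g=v, OF \<open>T > 0\<close> u v ZT Z]
  have blL: "bounded_linear L"
    unfolding L_def by (intro bounded_linear_intros)
  have L_pair: "L (a, b) = ((1/2) *\<^sub>R (a - b), (1/2) *\<^sub>R (a + b))" for a b by (simp add: L_def)
  have half: "(1/2) *\<^sub>R ((a + (y + x)) - (- b + (y - x))) = (1/2) *\<^sub>R (a + b) + x"
    "(1/2) *\<^sub>R ((a + (y + x)) + (- b + (y - x))) = (1/2) *\<^sub>R (a - b) + y" for a b x y :: 'a
    by (simp_all add: scaleR_right_distrib scaleR_right_diff_distrib flip: scaleR_left_distrib)
  show thesis
  proof
    show "L (Z (t + T)) = L (Z t)" for t by (simp add: ZT)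
    show "norm (fst (L (Z t))) \<le> 2 * G" for t
      using norm_triangle_ineq4[of "fst (Z t)" "snd (Z t)"] bound[of t] by (simp add: L_def)
    show "norm (snd (L (Z t))) \<le> 2 * G" for t
      using norm_triangle_ineq[of "fst (Z t)" "snd (Z t)"] bound[of t] by (simp add: L_def)
    fix t
    have "((\<lambda>t. L (Z t)) has_vector_derivative L (saddle_field u v t (Z t))) (at t)"
      by (rule bounded_linear.has_vector_derivative[OF blL Z])
    moreover have "L (saddle_field u v t (Z t)) =
        (snd (L (Z t)) + f t (L (Z t)), fst (L (Z t)) + g t (L (Z t)))"
      unfolding saddle_field_def u_def v_def L_pair half by (simp add: L_def[of "Z t"])
    ultimately show "((\<lambda>t. L (Z t)) has_vector_derivative
        (snd (L (Z t)) + f t (L (Z t)), fst (L (Z t)) + g t (L (Z t)))) (at t)" by simp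
  qed
qed

section \<open>Averaging\<close>

lemma oscillating_integral_bound:
  fixes \<phi> :: "real \<Rightarrow> 'b::euclidean_space"
  assumes "\<omega> > 0" "t \<ge> 0" and cont: "continuous_on UNIV \<phi>"
    and B: "\<And>s. norm (\<phi> s) \<le> B" and e: "\<And>s. norm (\<phi> s - \<phi> (s + pi / \<omega>)) \<le> e"
  shows "norm (integral {0..t} (\<lambda>s. cos (\<omega> * s) *\<^sub>R \<phi> s)) \<le> e * t / 2 + B * pi / \<omega>"
proof -
  let ?d = "pi / \<omega>" and ?\<psi> = "\<lambda>s. cos (\<omega> * s) *\<^sub>R \<phi> s"
  have d: "?d > 0" using \<open>\<omega> > 0\<close> by simp
  have cont\<psi>: "continuous_on A ?\<psi>" for A
    by (intro continuous_intros continuous_on_subset[OF cont]) auto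
  have int: "?\<psi> integrable_on {a..b}" for a b
    by (intro integrable_continuous_interval cont\<psi>)
  have contshift: "continuous_on A (\<lambda>s. \<phi> (s + ?d))" for A
    by (rule continuous_on_compose2[OF cont]) (auto intro!: continuous_intros)
  have small: "norm (integral {a..a + ?d} ?\<psi>) \<le> B * ?d" for a
  proof -
    have "norm (integral {a..a + ?d} ?\<psi>) \<le> integral {a..a + ?d} (\<lambda>_. B)"
    proof (intro integral_norm_bound_integral int)
      fix s
      have "\<bar>cos (\<omega> * s)\<bar> * norm (\<phi> s) \<le> 1 * B"
        using B[of s] by (intro mult_mono) auto
      then show "norm (?\<psi> s) \<le> B" by simp
    qed auto
    also have "\<dots> = B * ?d" using d by simp
    finally show ?thesis .
  qed
  \<comment> \<open>The cosine changes sign under a shift by half of its period.\<close>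
  have "integral {0..t} (\<lambda>s. ?\<psi> (s + ?d)) = integral {0 + ?d..t + ?d} ?\<psi>"
    using integral_shift_real_ivl[of "0 + ?d" ?d "t + ?d" ?\<psi>] by simp
  moreover have "?\<psi> (s + ?d) = - (cos (\<omega> * s) *\<^sub>R \<phi> (s + ?d))" for s
  proof -
    have "\<omega> * (s + ?d) = \<omega> * s + pi" using \<open>\<omega> > 0\<close> by (simp add: distrib_left)
    then show ?thesis by (simp only: cos_periodic_pi scaleR_minus_left)
  qed
  ultimately have shift: "integral {0 + ?d..t + ?d} ?\<psi> = - integral {0..t} (\<lambda>s. cos (\<omega> * s) *\<^sub>R \<phi> (s + ?d))"
    by simp
  have "integral {0..?d} ?\<psi> + integral {?d..t + ?d} ?\<psi> = integral {0..t + ?d} ?\<psi>"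
    using \<open>t \<ge> 0\<close> d by (intro Henstock_Kurzweil_Integration.integral_combine int) auto
  moreover have "integral {0..t} ?\<psi> + integral {t..t + ?d} ?\<psi> = integral {0..t + ?d} ?\<psi>"
    using \<open>t \<ge> 0\<close> d by (intro Henstock_Kurzweil_Integration.integral_combine int) auto
  moreover have "integral {0..t} (\<lambda>s. cos (\<omega> * s) *\<^sub>R (\<phi> s - \<phi> (s + ?d))) =
      integral {0..t} ?\<psi> - integral {0..t} (\<lambda>s. cos (\<omega> * s) *\<^sub>R \<phi> (s + ?d))"
    unfolding scaleR_right_diff_distrib
    by (intro Henstock_Kurzweil_Integration.integral_diff int integrable_continuous_interval
        continuous_intros contshift)
  ultimately have "2 *\<^sub>R integral {0..t} ?\<psi> = integral {0..t} (\<lambda>s. cos (\<omega> * s) *\<^sub>R (\<phi> s - \<phi> (s + ?d)))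
      + integral {0..0 + ?d} ?\<psi> - integral {t..t + ?d} ?\<psi>"
    using shift unfolding scaleR_2 by (simp add: algebra_simps)
  then have "norm (2 *\<^sub>R integral {0..t} ?\<psi>) \<le> norm (integral {0..t} (\<lambda>s. cos (\<omega> * s) *\<^sub>R (\<phi> s - \<phi> (s + ?d))))
      + norm (integral {0..0 + ?d} ?\<psi>) + norm (integral {t..t + ?d} ?\<psi>)"
    by (simp only:) (intro order_trans[OF norm_triangle_ineq4] add_mono norm_triangle_ineq order_refl)
  also have "norm (integral {0..t} (\<lambda>s. cos (\<omega> * s) *\<^sub>R (\<phi> s - \<phi> (s + ?d)))) \<le> integral {0..t} (\<lambda>_. e)"
  proof (intro integral_norm_bound_integral integrable_continuous_interval)
    show "continuous_on {0..t} (\<lambda>s. cos (\<omega> * s) *\<^sub>R (\<phi> s - \<phi> (s + ?d)))"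
      by (intro continuous_intros contshift continuous_on_subset[OF cont]) auto
    fix s
    have "\<bar>cos (\<omega> * s)\<bar> * norm (\<phi> s - \<phi> (s + ?d)) \<le> 1 * e"
      using e[of s] by (intro mult_mono) auto
    then show "norm (cos (\<omega> * s) *\<^sub>R (\<phi> s - \<phi> (s + ?d))) \<le> e" by simp
  qed auto
  also have "\<dots> = e * t" using \<open>t \<ge> 0\<close> by simp
  finally have "2 * norm (integral {0..t} ?\<psi>) \<le> e * t + B * ?d + B * ?d"
    using small[of 0] small[of t] by simp
  then show ?thesis by (simp add: field_simps)
qed

text \<open>A Riemann-Lebesgue lemma for functions that vary with the frequency. The common
  Lipschitz constant makes the change of \<open>x n\<close> over half a period tend to 0, and
  \<open>K\<close> is uniformly continuous on the ball that contains all values.\<close>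

lemma oscillating_integral_tendsto_0:
  fixes x :: "nat \<Rightarrow> real \<Rightarrow> 'b::euclidean_space" and K :: "'b \<Rightarrow> 'c::euclidean_space"
  assumes \<omega>: "filterlim \<omega> at_top sequentially" and contK: "continuous_on UNIV K"
    and B: "\<And>n s. norm (x n s) \<le> B" and lip: "\<And>n s t. norm (x n s - x n t) \<le> L * \<bar>s - t\<bar>"
    and "t \<ge> 0"
  shows "(\<lambda>n. integral {0..t} (\<lambda>s. cos (\<omega> n * s) *\<^sub>R K (x n s))) \<longlonglongrightarrow> 0"
proof (rule tendstoI)
  fix e :: real assume "e > 0"
  have L: "L \<ge> 0" using order_trans[OF norm_ge_zero lip[of 0 1 0]] by simp
  have "compact (K ` cball 0 B)"
    by (intro compact_continuous_image continuous_on_subset[OF contK]) auto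
  then have "bounded (K ` cball 0 B)" by (rule compact_imp_bounded)
  then obtain C where "\<And>z. z \<in> K ` cball 0 B \<Longrightarrow> norm z \<le> C"
    unfolding bounded_iff by blast
  then have C: "norm (K y) \<le> C" if "norm y \<le> B" for y using that by simp
  define \<eta> where "\<eta> = e / (t + 1)"
  have "\<eta> > 0" using \<open>e > 0\<close> \<open>t \<ge> 0\<close> by (simp add: \<eta>_def)
  have "uniformly_continuous_on (cball 0 B) K"
    by (intro compact_uniformly_continuous continuous_on_subset[OF contK]) auto
  then obtain d where "d > 0"
    and "\<And>y z. y \<in> cball 0 B \<Longrightarrow> z \<in> cball 0 B \<Longrightarrow> dist z y < d \<Longrightarrow> dist (K z) (K y) < \<eta>"
    unfolding uniformly_continuous_on_def using \<open>\<eta> > 0\<close> by blast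
  then have d: "dist (K z) (K y) < \<eta>" if "norm y \<le> B" "norm z \<le> B" "dist z y < d" for y z
    using that by simp
  have inv: "(\<lambda>n. inverse (\<omega> n)) \<longlonglongrightarrow> 0"
    by (rule tendsto_inverse_0_at_top[OF \<omega>])
  have "(\<lambda>n. L * pi * inverse (\<omega> n)) \<longlonglongrightarrow> L * pi * 0" "(\<lambda>n. C * pi * inverse (\<omega> n)) \<longlonglongrightarrow> C * pi * 0"
    by (intro tendsto_intros inv)+
  then have "\<forall>\<^sub>F n in sequentially. L * pi * inverse (\<omega> n) < d"
    "\<forall>\<^sub>F n in sequentially. C * pi * inverse (\<omega> n) < e / 2"
    using \<open>d > 0\<close> half_gt_zero[OF \<open>e > 0\<close>] by (simp_all only: mult_zero_right order_tendstoD)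
  moreover have "\<forall>\<^sub>F n in sequentially. 0 < \<omega> n"
    using \<omega> by (simp add: filterlim_at_top_dense)
  ultimately show "\<forall>\<^sub>F n in sequentially. dist (integral {0..t} (\<lambda>s. cos (\<omega> n * s) *\<^sub>R K (x n s))) 0 < e"
  proof eventually_elim
    case (elim n)
    have "continuous_on UNIV (x n)"
      by (rule lipschitz_on_continuous_on[of L], rule lipschitz_onI)
        (use lip L in \<open>auto simp: dist_norm\<close>)
    then have "continuous_on UNIV (\<lambda>s. K (x n s))"
      by (rule continuous_on_compose2[OF contK]) auto
    then have "norm (integral {0..t} (\<lambda>s. cos (\<omega> n * s) *\<^sub>R K (x n s))) \<le> \<eta> * t / 2 + C * pi / \<omega> n"
    proof (rule oscillating_integral_bound[OF \<open>0 < \<omega> n\<close> \<open>t \<ge> 0\<close>])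
      show "norm (K (x n s)) \<le> C" for s using C B by blast
      fix s
      have "dist (x n s) (x n (s + pi / \<omega> n)) \<le> L * (pi / \<omega> n)"
        using lip[of n s "s + pi / \<omega> n"] elim by (simp add: dist_norm)
      also have "\<dots> = L * pi * inverse (\<omega> n)" by (simp only: divide_inverse mult.assoc)
      also have "\<dots> < d" by (rule elim(1))
      finally have "dist (x n s) (x n (s + pi / \<omega> n)) < d" .
      then have "dist (K (x n s)) (K (x n (s + pi / \<omega> n))) < \<eta>"
        by (rule d[OF B B])
      then show "norm (K (x n s) - K (x n (s + pi / \<omega> n))) \<le> \<eta>" by (simp add: dist_norm)
    qed
    also have "\<eta> * t / 2 + C * pi / \<omega> n < e / 2 + e / 2"
    proof (rule add_le_less_mono)
      show "\<eta> * t / 2 \<le> e / 2" using \<open>e > 0\<close> \<open>t \<ge> 0\<close> by (simp add: \<eta>_def field_simps)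
      show "C * pi / \<omega> n < e / 2" using elim(2) by (simp only: divide_inverse[of "C * pi"])
    qed
    finally show ?case by simp
  qed
qed

text \<open>The vector fields differ from \<open>F\<close> by terms that do not become small; only
  their integrals along the solutions do. The bound \<open>L\<close> on the velocities keeps the
  solutions equi-Lipschitz, so these integrals tend to 0 although the solutions depend on \<omega>.
  The two frequencies are those of \<eta> and of \<open>\<eta>^2\<close>.\<close>

theorem averaging_periodic:
  fixes x :: "nat \<Rightarrow> real \<Rightarrow> 'b::euclidean_space" and F :: "real \<Rightarrow> 'b \<Rightarrow> 'b"
  assumes "T > 0"
    and FT: "\<And>t x. F (t + T) x = F t x"
    and contF: "continuous_on UNIV (\<lambda>(t, x). F t x)"
    and contK: "continuous_on UNIV K1" "continuous_on UNIV K2"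
    and \<omega>: "filterlim \<omega> at_top sequentially"
    and B: "\<And>n t. norm (x n t) \<le> B" and xT: "\<And>n t. x n (t + T) = x n t"
    and deriv: "\<And>n t. (x n has_vector_derivative
      F t (x n t) + cos (\<omega> n * t) *\<^sub>R K1 (x n t) + cos (2 * \<omega> n * t) *\<^sub>R K2 (x n t)) (at t)"
    and L: "\<And>n t. norm (F t (x n t) + cos (\<omega> n * t) *\<^sub>R K1 (x n t) + cos (2 * \<omega> n * t) *\<^sub>R K2 (x n t)) \<le> L"
  obtains X r where "strict_mono (r :: nat \<Rightarrow> nat)" "\<And>t. X (t + T) = X t"
    "\<And>t. (X has_vector_derivative F t (X t)) (at t)"
    "uniform_limit {0..T} (\<lambda>n. x (r n)) X sequentially"
proof -
  have lip: "norm (x n s - x n t) \<le> L * \<bar>s - t\<bar>" for n s t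
  proof -
    have "norm (x n s - x n t) \<le> L * norm (s - t)"
    proof (rule differentiable_bound[of UNIV])
      fix u :: real
      show "(x n has_derivative (\<lambda>h. h *\<^sub>R (F u (x n u) + cos (\<omega> n * u) *\<^sub>R K1 (x n u) + cos (2 * \<omega> n * u) *\<^sub>R K2 (x n u)))) (at u within UNIV)"
        using deriv[of n u] by (simp add: has_vector_derivative_def)
      show "onorm (\<lambda>h. h *\<^sub>R (F u (x n u) + cos (\<omega> n * u) *\<^sub>R K1 (x n u) + cos (2 * \<omega> n * u) *\<^sub>R K2 (x n u))) \<le> L"
      proof (rule onorm_le)
        fix h :: real
        have "\<bar>h\<bar> * norm (F u (x n u) + cos (\<omega> n * u) *\<^sub>R K1 (x n u) + cos (2 * \<omega> n * u) *\<^sub>R K2 (x n u)) \<le> \<bar>h\<bar> * L"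
          by (intro mult_left_mono L) simp
        then show "norm (h *\<^sub>R (F u (x n u) + cos (\<omega> n * u) *\<^sub>R K1 (x n u) + cos (2 * \<omega> n * u) *\<^sub>R K2 (x n u))) \<le> L * norm h"
          by (simp only: norm_scaleR real_norm_def mult.commute)
      qed
    qed auto
    then show ?thesis by simp
  qed
  have resid: "(\<lambda>n. x n t - x n 0 - integral {0..t} (\<lambda>s. F s (x n s))) \<longlonglongrightarrow> 0"
    if t: "t \<in> {0..2*T}" for t
  proof -
    have contx: "continuous_on A (x n)" for n A
      by (rule continuous_on_vector_derivative) (rule has_vector_derivative_at_within[OF deriv])
    have cK: "continuous_on A (\<lambda>s. K1 (x n s))" "continuous_on A (\<lambda>s. K2 (x n s))" for n A
      by (intro continuous_on_compose2[OF contK(1) contx] continuous_on_compose2[OF contK(2) contx]; simp)+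
    have cF: "continuous_on A (\<lambda>s. F s (x n s))" for n A
      using continuous_on_compose2[OF contF, of A "\<lambda>s. (s, x n s)"] contx[of A n]
      by (simp add: continuous_on_Pair)
    have eq: "x n t - x n 0 - integral {0..t} (\<lambda>s. F s (x n s)) =
        integral {0..t} (\<lambda>s. cos (\<omega> n * s) *\<^sub>R K1 (x n s)) +
        integral {0..t} (\<lambda>s. cos (2 * \<omega> n * s) *\<^sub>R K2 (x n s))" for n
    proof -
      have "((\<lambda>s. F s (x n s) + cos (\<omega> n * s) *\<^sub>R K1 (x n s) + cos (2 * \<omega> n * s) *\<^sub>R K2 (x n s))
          has_integral (x n t - x n 0)) {0..t}"
        using t by (intro fundamental_theorem_of_calculus has_vector_derivative_at_within[OF deriv]) auto
      then have "x n t - x n 0 = integral {0..t}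
          (\<lambda>s. F s (x n s) + cos (\<omega> n * s) *\<^sub>R K1 (x n s) + cos (2 * \<omega> n * s) *\<^sub>R K2 (x n s))"
        by (simp add: integral_unique)
      also have "\<dots> = integral {0..t} (\<lambda>s. F s (x n s)) +
        integral {0..t} (\<lambda>s. cos (\<omega> n * s) *\<^sub>R K1 (x n s)) +
        integral {0..t} (\<lambda>s. cos (2 * \<omega> n * s) *\<^sub>R K2 (x n s))"
      proof -
        have i: "(\<lambda>s. F s (x n s)) integrable_on {0..t}"
          "(\<lambda>s. cos (\<omega> n * s) *\<^sub>R K1 (x n s)) integrable_on {0..t}"
          "(\<lambda>s. cos (2 * \<omega> n * s) *\<^sub>R K2 (x n s)) integrable_on {0..t}"
          by (intro integrable_continuous_interval continuous_intros cF cK)+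
        show ?thesis
          by (simp only: Henstock_Kurzweil_Integration.integral_add[OF integrable_add[OF i(1,2)] i(3)]
              Henstock_Kurzweil_Integration.integral_add[OF i(1,2)])
      qed
      finally show ?thesis by simp
    qed
    have "filterlim (\<lambda>n. 2 * \<omega> n) at_top sequentially"
      by (rule filterlim_tendsto_pos_mult_at_top[OF tendsto_const _ \<omega>]) simp
    then have "(\<lambda>n. integral {0..t} (\<lambda>s. cos (2 * \<omega> n * s) *\<^sub>R K2 (x n s))) \<longlonglongrightarrow> 0"
      by (rule oscillating_integral_tendsto_0[OF _ contK(2) B lip]) (use t in auto)
    moreover have "(\<lambda>n. integral {0..t} (\<lambda>s. cos (\<omega> n * s) *\<^sub>R K1 (x n s))) \<longlonglongrightarrow> 0"
      by (rule oscillating_integral_tendsto_0[OF \<omega> contK(1) B lip]) (use t in auto)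
    ultimately have "(\<lambda>n. integral {0..t} (\<lambda>s. cos (\<omega> n * s) *\<^sub>R K1 (x n s)) +
        integral {0..t} (\<lambda>s. cos (2 * \<omega> n * s) *\<^sub>R K2 (x n s))) \<longlonglongrightarrow> 0 + 0"
      by (intro tendsto_add)
    then show ?thesis unfolding eq by simp
  qed
  show thesis
  proof (rule periodic_solution_of_approximations[of T F x B L])
    fix X and r :: "nat \<Rightarrow> nat"
    assume X: "strict_mono r" "\<And>t. X (t + T) = X t"
      "\<And>t. (X has_vector_derivative F t (X t)) (at t)" "uniform_limit {0..T} (\<lambda>n. x (r n)) X sequentially"
    show thesis by (rule that[of r X, OF X])
  next
    show "norm (x n s - x n t) \<le> L * \<bar>s - t\<bar>" for n s t by (rule lip)
    show "(\<lambda>n. x n t - x n 0 - integral {0..t} (\<lambda>s. F s (x n s))) \<longlonglongrightarrow> 0"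
      if "t \<in> {0..2*T}" for t by (rule resid[OF that])
  qed (rule \<open>T > 0\<close> FT contF B xT)+
qed

section \<open>The truncated pendulum in the stereographic chart\<close>

text \<open>The radial retraction onto the closed disc of radius \<open>R\<close>. The divisor is at
  least 1, so continuity needs no case distinction.\<close>

definition clip :: "real \<Rightarrow> complex \<Rightarrow> complex" where
  "clip R v = v /\<^sub>R max 1 (norm v / R)"

definition wedge :: "complex \<Rightarrow> complex \<Rightarrow> real" where
  "wedge u v = Im (cnj u * v)"

text \<open>In stereographic coordinates the line element of the unit sphere is
  \<open>|dq| / s\<close>. Outside the unit disc \<open>s\<close> is frozen at 1, which freezes the
  height \<open>1 / s - 1\<close> at 0.\<close>

definition conf_factor :: "complex \<Rightarrow> real" where
  "conf_factor q = (1 + (norm (clip 1 q))\<^sup>2) / 2"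

text \<open>
  The truncated equations of motion are \<open>q' = w + drift_q\<close>, \<open>w' = q + drift_w\<close>. The parameters \<open>e1\<close> and
  \<open>e2\<close> stand for \<open>\<eta>\<close> and \<open>\<eta>\<^sup>2\<close>; they are kept apart because averaging replaces them by \<open>0\<close> and by the mean
  of \<open>\<eta>\<^sup>2\<close>. The point of the unit sphere is \<open>(Re q / s, 1 / s - 1, Im q / s)\<close> with \<open>s = conf_factor q\<close>, the
  frame consists of the coordinate fields multiplied by \<open>s\<close>, and the term with \<open>\<i> * w\<close> is the rotation of
  this frame under parallel transport. It is divided by \<open>max 1 \<bar>q\<bar>\<close> so that great circles are not bent
  inwards outside the disc.
\<close>

definition drift_q :: "real \<Rightarrow> real \<Rightarrow> complex \<times> complex \<Rightarrow> complex" where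
  "drift_q R e1 x = (conf_factor (fst x) - 1) *\<^sub>R clip R (snd x) + e1 *\<^sub>R clip 1 (fst x)"

definition drift_w :: "real \<Rightarrow> real \<Rightarrow> complex \<Rightarrow> real \<Rightarrow> real \<Rightarrow> complex \<times> complex \<Rightarrow> complex" where
  "drift_w \<mu> R p e1 e2 x =
    (let q = clip 1 (fst x); w = clip R (snd x); s = conf_factor (fst x); y = 1 / s - 1 in
      (wedge q w / max 1 (norm (fst x))) *\<^sub>R (\<i> * w) + y *\<^sub>R q - \<mu> *\<^sub>R w + p - (inner p q / s) *\<^sub>R q
      - (\<mu> * e1 / s) *\<^sub>R q - (e1 * y) *\<^sub>R w - (e2 * y / s) *\<^sub>R q)"

lemma clip_scaled:
  assumes "R > 0"
  obtains \<alpha> where "clip R v = \<alpha> *\<^sub>R v" "0 < \<alpha>" "\<alpha> \<le> 1" "\<alpha> * norm v \<le> R"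
    "norm v \<le> R \<Longrightarrow> \<alpha> = 1" "norm v \<ge> R \<Longrightarrow> \<alpha> * norm v = R"
proof
  let ?\<alpha> = "inverse (max 1 (norm v / R))"
  show "clip R v = ?\<alpha> *\<^sub>R v" by (simp add: clip_def)
  show "0 < ?\<alpha>" by simp
  show "?\<alpha> \<le> 1" by (rule inverse_le_1_iff[THEN iffD2]) simp
  show *: "?\<alpha> * norm v = R" if "norm v \<ge> R"
  proof -
    have "max 1 (norm v / R) = norm v / R" using that assms by (simp add: max_absorb2)
    then show ?thesis using that assms by (auto simp: field_simps)
  qed
  show **: "?\<alpha> = 1" if "norm v \<le> R"
    using that assms by (simp add: max_absorb1)
  show "?\<alpha> * norm v \<le> R"
  proof (cases "norm v \<le> R")
    case True
    then show ?thesis using **[OF True] by simp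
  next
    case False
    then show ?thesis using * by simp
  qed
qed

lemma norm_clip_le: "R > 0 \<Longrightarrow> norm (clip R v) \<le> R"
  by (rule clip_scaled[of R v]) auto

lemma clip_id: "R > 0 \<Longrightarrow> norm v \<le> R \<Longrightarrow> clip R v = v"
  by (rule clip_scaled[of R v]) auto

lemma continuous_on_clip [continuous_intros]:
  assumes "continuous_on A f" "R > 0"
  shows "continuous_on A (\<lambda>x. clip R (f x))"
proof -
  have "max 1 a \<noteq> 0" for a :: real by (simp add: max_def)
  then show ?thesis unfolding clip_def
    by (intro continuous_intros assms(1)) (use assms(2) in auto)
qed

lemma conf_factor_bounds: "1 / 2 \<le> conf_factor q" "conf_factor q \<le> 1"
proof -
  have "(norm (clip 1 q))\<^sup>2 \<le> 1" using norm_clip_le[of 1 q] by (simp add: power_le_one)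
  then show "1 / 2 \<le> conf_factor q" "conf_factor q \<le> 1" unfolding conf_factor_def by auto
qed

lemma conf_factor_inverse_bounds: "\<bar>1 / conf_factor q\<bar> \<le> 2" "0 \<le> 1 / conf_factor q - 1" "1 / conf_factor q - 1 \<le> 1"
proof -
  have s: "conf_factor q > 0" using conf_factor_bounds(1)[of q] by linarith
  then show "\<bar>1 / conf_factor q\<bar> \<le> 2" "0 \<le> 1 / conf_factor q - 1" "1 / conf_factor q - 1 \<le> 1"
    using conf_factor_bounds[of q] by (auto simp: field_simps)
qed

lemma continuous_on_conf_factor [continuous_intros]:
  "continuous_on A f \<Longrightarrow> continuous_on A (\<lambda>x. conf_factor (f x))"
  unfolding conf_factor_def by (intro continuous_intros) auto

lemma continuous_on_drift_q:
  assumes "R > 0" "continuous_on A e" "continuous_on A f"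
  shows "continuous_on A (\<lambda>z. drift_q R (e z) (f z))"
  unfolding drift_q_def by (intro continuous_intros assms) auto

lemma continuous_on_drift_w:
  assumes "R > 0" "continuous_on A p" "continuous_on A e1" "continuous_on A e2" "continuous_on A f"
  shows "continuous_on A (\<lambda>z. drift_w \<mu> R (p z) (e1 z) (e2 z) (f z))"
proof -
  have "conf_factor q \<noteq> 0" for q using conf_factor_bounds(1)[of q] by linarith
  moreover have "max 1 a \<noteq> 0" for a :: real by (simp add: max_def)
  ultimately show ?thesis
    unfolding drift_w_def Let_def wedge_def by (intro continuous_intros assms) auto
qed

lemma abs_wedge_le: "\<bar>wedge u v\<bar> \<le> norm u * norm v"
  unfolding wedge_def using abs_Im_le_cmod[of "cnj u * v"] by (simp add: norm_mult)

lemma norm_drift_q_le: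
  assumes "R > 0" "\<bar>e1\<bar> \<le> E"
  shows "norm (drift_q R e1 x) \<le> R + E"
proof -
  have "norm (drift_q R e1 x) \<le> norm ((conf_factor (fst x) - 1) *\<^sub>R clip R (snd x)) + norm (e1 *\<^sub>R clip 1 (fst x))"
    unfolding drift_q_def by (rule norm_triangle_ineq)
  also have "\<dots> \<le> 1 * R + E * 1"
    unfolding norm_scaleR
    using conf_factor_bounds[of "fst x"] assms norm_clip_le[of R] norm_clip_le[of 1]
    by (intro add_mono mult_mono) auto
  finally show ?thesis by simp
qed

text \<open>The summands are, in order, the rotation of the frame, gravity beyond its linear part,
  friction, the force projected to the tangent plane (two summands), and three vibration terms. The
  latter arise because \<open>w\<close> exceeds the relative velocity by \<eta> times the tangential
  part of the upward unit vector, which is \<open>- q / s\<close> in the frame.\<close>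

lemma norm_drift_w_le:
  assumes "R > 0" "\<bar>e1\<bar> \<le> E1" "\<bar>e2\<bar> \<le> E2" "norm p \<le> P" "\<mu> > 0"
  shows "norm (drift_w \<mu> R p e1 e2 x) \<le> R * R + 1 + \<mu> * R + P + 2 * P + 2 * \<mu> * E1 + E1 * R + 2 * E2"
proof -
  define q w s y where "q = clip 1 (fst x)" and "w = clip R (snd x)" and "s = conf_factor (fst x)" and "y = 1 / s - 1"
  have q: "norm q \<le> 1" and w: "norm w \<le> R" using norm_clip_le assms by (auto simp: q_def w_def)
  have s: "\<bar>1 / s\<bar> \<le> 2" and y: "\<bar>y\<bar> \<le> 1" using conf_factor_inverse_bounds[of "fst x"] by (auto simp: s_def y_def)
  have E: "E1 \<ge> 0" "E2 \<ge> 0" "P \<ge> 0" using assms(2-4) norm_ge_zero[of p] by linarith+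
  have "\<bar>wedge q w / max 1 (norm (fst x))\<bar> \<le> \<bar>wedge q w\<bar>"
    by (simp add: divide_le_eq mult_le_cancel_left1)
  also have "\<dots> \<le> norm q * norm w" by (rule abs_wedge_le)
  also have "\<dots> \<le> 1 * R" using q w by (intro mult_mono) auto
  finally have "norm ((wedge q w / max 1 (norm (fst x))) *\<^sub>R (\<i> * w)) \<le> R * R"
    unfolding norm_scaleR using w assms(1) by (intro mult_mono) (auto simp: norm_mult)
  moreover have "norm (y *\<^sub>R q) \<le> 1 * 1"
    unfolding norm_scaleR using q y by (intro mult_mono) auto
  moreover have "norm (\<mu> *\<^sub>R w) \<le> \<mu> * R"
    unfolding norm_scaleR using w \<open>\<mu> > 0\<close> by (intro mult_mono) auto
  moreover have "norm ((inner p q / s) *\<^sub>R q) \<le> 2 * P"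
  proof -
    have "\<bar>inner p q\<bar> \<le> norm p * norm q" by (rule Cauchy_Schwarz_ineq2)
    also have "\<dots> \<le> P * 1" using assms q E by (intro mult_mono) auto
    finally have "\<bar>inner p q\<bar> * \<bar>1 / s\<bar> * norm q \<le> P * 2 * 1"
      using s q E by (intro mult_mono) auto
    then show ?thesis by (simp add: abs_divide mult.commute)
  qed
  moreover have "norm ((\<mu> * e1 / s) *\<^sub>R q) \<le> 2 * \<mu> * E1"
  proof -
    have "\<mu> * \<bar>e1\<bar> * \<bar>1 / s\<bar> * norm q \<le> \<mu> * E1 * 2 * 1"
      using s q E assms by (intro mult_mono) auto
    then show ?thesis using assms by (simp add: abs_divide abs_mult mult.commute)
  qed
  moreover have "norm ((e1 * y) *\<^sub>R w) \<le> E1 * R"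
  proof -
    have "\<bar>e1\<bar> * \<bar>y\<bar> * norm w \<le> E1 * 1 * R"
      using y w E assms by (intro mult_mono) auto
    then show ?thesis by (simp add: abs_mult)
  qed
  moreover have "norm ((e2 * y / s) *\<^sub>R q) \<le> 2 * E2"
  proof -
    have "\<bar>e2\<bar> * \<bar>y\<bar> * \<bar>1 / s\<bar> * norm q \<le> E2 * 1 * 2 * 1"
      using y s q E assms by (intro mult_mono) auto
    then show ?thesis by (simp add: abs_divide abs_mult mult.commute)
  qed
  moreover have tri: "norm (a + b - c + d - e - f - g - h) \<le>
      norm a + norm b + norm c + norm d + norm e + norm f + norm g + norm h" for a b c d e f g h :: complex
    by (intro order_trans[OF norm_triangle_ineq4] order_trans[OF norm_triangle_ineq] add_mono order_refl)
  have eq: "drift_w \<mu> R p e1 e2 x = (wedge q w / max 1 (norm (fst x))) *\<^sub>R (\<i> * w) + y *\<^sub>R q - \<mu> *\<^sub>R w + p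
      - (inner p q / s) *\<^sub>R q - (\<mu> * e1 / s) *\<^sub>R q - (e1 * y) *\<^sub>R w - (e2 * y / s) *\<^sub>R q"
    unfolding drift_w_def Let_def q_def w_def s_def y_def ..
  have "norm (drift_w \<mu> R p e1 e2 x) \<le> norm ((wedge q w / max 1 (norm (fst x))) *\<^sub>R (\<i> * w)) + norm (y *\<^sub>R q)
      + norm (\<mu> *\<^sub>R w) + norm p + norm ((inner p q / s) *\<^sub>R q) + norm ((\<mu> * e1 / s) *\<^sub>R q)
      + norm ((e1 * y) *\<^sub>R w) + norm ((e2 * y / s) *\<^sub>R q)"
    unfolding eq by (rule tri)
  ultimately show ?thesis using \<open>norm p \<le> P\<close> by linarith
qed

text \<open>
  Here \<open>r = \<bar>q\<bar>\<close>, \<open>W = \<bar>w\<bar>\<^sup>2\<close>, \<open>\<pi>\<close> is the inner product of the force with \<open>q\<close>, and \<open>\<alpha>\<close>, \<open>\<gamma>\<close> are the factors by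
  which \<open>w\<close> and \<open>q\<close> are clipped. The terms with \<open>W\<close> are nonnegative by themselves: a geodesic tangent to a
  circle of latitude bends towards the equator.
\<close>

lemma outward_push_real:
  fixes r W \<alpha> \<gamma> s \<pi> c P :: real
  assumes "r \<ge> 0" "W \<ge> 0" "0 < \<alpha>" "\<alpha> \<le> 1" and \<gamma>: "\<gamma> = 1 / max 1 r" and s: "s = (1 + (\<gamma> * r)\<^sup>2) / 2"
    and \<pi>: "\<bar>\<pi>\<bar> \<le> P * r" and "c \<ge> 0" "P \<ge> 0" and r: "r > 1 - 1 / (2 * (c + 2 * P + 1))"
  shows "0 < (1 + (s - 1) * \<alpha>) * W - (\<gamma> * \<alpha> * r)\<^sup>2 * W + r\<^sup>2 + (1 / s - 1) * \<gamma> * r\<^sup>2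
    + \<pi> - \<gamma>\<^sup>2 * \<pi> * r\<^sup>2 / s - c * (1 / s - 1) / s * \<gamma> * r\<^sup>2"
proof -
  have \<alpha>2: "\<alpha>\<^sup>2 \<le> \<alpha>" using assms by (simp add: power2_eq_square mult_left_le)
  show ?thesis
  proof (cases "r \<ge> 1")
    \<comment> \<open>Beyond the horizon \<open>s = 1\<close>, so the vibration term vanishes; with
      \<open>\<gamma> * r = 1\<close> the projection cancels the radial part of the force. Only the
      untruncated gravity \<open>r^2\<close> remains.\<close>
    case True
    then have gr: "\<gamma> * r = 1" and "s = 1" using \<gamma> s by (auto simp: max_absorb2)
    have "\<gamma>\<^sup>2 * \<pi> * r\<^sup>2 = (\<gamma> * r)\<^sup>2 * \<pi>" by (simp add: power_mult_distrib)
    then have e1: "\<gamma>\<^sup>2 * \<pi> * r\<^sup>2 = \<pi>" by (simp add: gr)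
    have e2: "(\<gamma> * \<alpha> * r)\<^sup>2 = \<alpha>\<^sup>2" using gr by (metis mult.assoc mult.commute mult_1_right)
    have "\<alpha>\<^sup>2 * W \<le> 1 * W" using \<alpha>2 assms by (intro mult_right_mono) auto
    moreover have "r\<^sup>2 > 0" using True by auto
    ultimately have "0 < W - \<alpha>\<^sup>2 * W + r\<^sup>2" by linarith
    then show ?thesis unfolding \<open>s = 1\<close> e1 e2 by simp
  next
    case False
    then have "\<gamma> = 1" using \<gamma> by simp
    define y where "y = 1 / s - 1"
    have s': "s = (1 + r\<^sup>2) / 2" using s \<open>\<gamma> = 1\<close> by simp
    have r2: "r\<^sup>2 \<le> 1" using False \<open>r \<ge> 0\<close> by (simp add: power_le_one)
    have s0: "0 < s" "s \<le> 1" using r2 unfolding s' by (auto simp: add_pos_nonneg)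
    have r2s: "r\<^sup>2 = 2 * s - 1" using s' by simp
    have y0: "y \<ge> 0" unfolding y_def using s0 by simp
    \<comment> \<open>The height satisfies \<open>y \<le> 1 - r^2 \<le> 2 * (1 - r)\<close>. The
      threshold for \<open>r\<close> is chosen to make this smaller than
      \<open>1 / (c + 2 * P + 1)\<close>, so that vibration and force cannot outweigh
      gravity.\<close>
    have "y = (1 - r\<^sup>2) / (1 + r\<^sup>2)" unfolding y_def s' by (simp add: field_simps add_nonneg_eq_0_iff)
    also have "\<dots> \<le> (1 - r\<^sup>2) / 1" using r2 by (intro divide_left_mono) (auto simp: add_pos_nonneg)
    also have "\<dots> = (1 - r) * (1 + r)" by (simp add: power2_eq_square algebra_simps)
    also have "\<dots> \<le> (1 - r) * 2" using False by (intro mult_left_mono) auto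
    also have "\<dots> < 1 / (2 * (c + 2 * P + 1)) * 2" using r by (intro mult_strict_right_mono) auto
    also have "\<dots> = 1 / (c + 2 * P + 1)" using assms(8,9) by (simp add: field_simps)
    finally have "y * (c + 2 * P + 1) < 1" using assms(8,9) by (simp add: field_simps)
    then have key: "c * y + 2 * (P * y) < 1" using y0 by (simp add: algebra_simps)
    have "1 / (2 * (c + 2 * P + 1)) \<le> 1 / 2" using assms(8,9) by (simp add: field_simps)
    then have rhalf: "1 / 2 < r" using r by linarith
    have Py: "0 \<le> P * y" "0 \<le> c * y" using y0 assms by auto
    have "P * y < 1 / 2 * (1 - c * y)" using key by simp
    also have "\<dots> \<le> r * (1 - c * y)" using rhalf key Py by (intro mult_right_mono) auto
    finally have "0 < r * (r * (1 - c * y) - P * y)" using rhalf by (intro mult_pos_pos) auto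
    then have "0 < r\<^sup>2 * (1 - c * y) - P * r * y" by (simp add: algebra_simps power2_eq_square)
    also have "\<dots> \<le> r\<^sup>2 * (1 - c * y) / s + \<pi> * y"
    proof -
      have "0 \<le> r\<^sup>2 * (1 - c * y)" using key Py by (intro mult_nonneg_nonneg) auto
      then have "r\<^sup>2 * (1 - c * y) \<le> r\<^sup>2 * (1 - c * y) / s"
        using s0 by (simp add: le_divide_eq mult_left_le)
      moreover have "- (P * r) * y \<le> \<pi> * y" using \<pi> y0 by (intro mult_right_mono) auto
      ultimately show ?thesis by simp
    qed
    also have "\<dots> = r\<^sup>2 + y * r\<^sup>2 + \<pi> - \<pi> * r\<^sup>2 / s - c * y / s * r\<^sup>2"
    proof -
      \<comment> \<open>By \<open>r^2 = 2 * s - 1\<close>, \<open>u\<close> has the two forms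
        \<open>r^2 * (1 + y)\<close> and \<open>1 - y\<close>. The second shows that projection
        leaves only \<open>\<pi> * y\<close> of the radial force, which vanishes at the
        horizon.\<close>
      define u where "u = r\<^sup>2 / s"
      have "1 / s = 1 + y" by (simp add: y_def)
      then have u1: "u = r\<^sup>2 * (1 + y)" by (simp add: u_def divide_inverse)
      have u2: "u = 1 - y" unfolding u_def r2s y_def using s0 by (simp add: field_simps)
      have eqs: "r\<^sup>2 * (1 - c * y) / s = u * (1 - c * y)" "\<pi> * r\<^sup>2 / s = \<pi> * u" "c * y / s * r\<^sup>2 = c * y * u"
        by (simp_all add: u_def)
      show ?thesis unfolding eqs using u1 u2 by algebra
    qed
    finally have force: "0 < r\<^sup>2 + y * r\<^sup>2 + \<pi> - \<pi> * r\<^sup>2 / s - c * y / s * r\<^sup>2" .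
    \<comment> \<open>Here \<open>1 - s + r^2 = s \<le> 1\<close>, so the leading 1 dominates both
      clipped terms.\<close>
    have "\<alpha>\<^sup>2 * r\<^sup>2 \<le> \<alpha> * r\<^sup>2" using \<alpha>2 by (intro mult_right_mono) auto
    moreover have "\<alpha> * (1 - s + r\<^sup>2) \<le> 1 * 1"
      using assms s0 r2s by (intro mult_mono) auto
    ultimately have "0 \<le> 1 + (s - 1) * \<alpha> - \<alpha>\<^sup>2 * r\<^sup>2" by (simp add: algebra_simps)
    then have "0 \<le> (1 + (s - 1) * \<alpha> - \<alpha>\<^sup>2 * r\<^sup>2) * W" using \<open>W \<ge> 0\<close> by (rule mult_nonneg_nonneg)
    with force show ?thesis by (simp add: \<open>\<gamma> = 1\<close> power_mult_distrib algebra_simps y_def)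
  qed
qed

lemma inner_ii: "inner q (\<i> * w) = - wedge q w"
  by (simp add: wedge_def inner_complex_def algebra_simps)

lemma inner_ii_self: "inner w (\<i> * w) = 0"
  by (simp add: inner_complex_def algebra_simps)

lemma wedge_scaleR: "wedge (a *\<^sub>R u) (b *\<^sub>R v) = a * b * wedge u v"
  by (simp add: wedge_def algebra_simps)

lemma wedge_inner_squares: "(wedge u v)\<^sup>2 + (inner u v)\<^sup>2 = (norm u)\<^sup>2 * (norm v)\<^sup>2"
  unfolding wedge_def inner_complex_def cmod_power2 by (simp add: power2_eq_square algebra_simps)

text \<open>The derivative of the inner product of \<open>q\<close> and \<open>w\<close> at a critical point of \<open>\<bar>q\<bar>\<close>.\<close>

lemma outward_push:
  assumes "R > 0" "c \<ge> 0" "norm p \<le> P" "inner q w = 0"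
    and r: "norm q > 1 - 1 / (2 * (c + 2 * P + 1))"
  shows "0 < inner (w + drift_q R 0 (q, w)) w + inner q (q + drift_w \<mu> R p 0 c (q, w))"
proof -
  obtain \<alpha> where \<alpha>: "clip R w = \<alpha> *\<^sub>R w" "0 < \<alpha>" "\<alpha> \<le> 1" by (rule clip_scaled[OF \<open>R > 0\<close>])
  define \<gamma> where "\<gamma> = 1 / max 1 (norm q)"
  define s where "s = conf_factor q"
  define y where "y = 1 / s - 1"
  have \<gamma>: "clip 1 q = \<gamma> *\<^sub>R q" "\<gamma> \<ge> 0" by (auto simp: clip_def \<gamma>_def divide_inverse)
  have s: "s = (1 + (\<gamma> * norm q)\<^sup>2) / 2" using \<gamma> by (simp add: s_def conf_factor_def)
  have "P \<ge> 0" using assms(3) norm_ge_zero[of p] by linarith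
  have "\<bar>inner p q\<bar> \<le> P * norm q"
    using Cauchy_Schwarz_ineq2[of p q] mult_right_mono[OF assms(3), of "norm q"] by simp
  from outward_push_real[OF norm_ge_zero zero_le_power2 \<alpha>(2,3) \<gamma>_def s this \<open>c \<ge> 0\<close> \<open>P \<ge> 0\<close> r, of "norm w"]
  have pos: "0 < (1 + (s - 1) * \<alpha>) * (norm w)\<^sup>2 - (\<gamma> * \<alpha> * norm q)\<^sup>2 * (norm w)\<^sup>2 + (norm q)\<^sup>2 + y * \<gamma> * (norm q)\<^sup>2
    + inner p q - \<gamma>\<^sup>2 * inner p q * (norm q)\<^sup>2 / s - c * y / s * \<gamma> * (norm q)\<^sup>2"
    by (simp add: y_def)
  \<comment> \<open>As \<open>w\<close> is orthogonal to \<open>q\<close>, the cross product has its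
    largest modulus and the rotation of the frame pulls inwards most strongly; \<open>|w|^2\<close>
    has to balance it.\<close>
  have wd: "(wedge q w)\<^sup>2 = (norm q)\<^sup>2 * (norm w)\<^sup>2"
    using wedge_inner_squares[of q w] assms(4) by simp
  have 1: "inner (w + drift_q R 0 (q, w)) w = (1 + (s - 1) * \<alpha>) * (norm w)\<^sup>2"
    by (simp add: drift_q_def \<alpha> s_def inner_add_left algebra_simps power2_norm_eq_inner)
  have 2: "inner q (q + drift_w \<mu> R p 0 c (q, w)) =
      (norm q)\<^sup>2 - (\<gamma> * \<alpha> * wedge q w) * \<gamma> * (\<alpha> * wedge q w) + y * (\<gamma> * (norm q)\<^sup>2) + inner p q
      - (\<gamma> * inner p q / s) * (\<gamma> * (norm q)\<^sup>2) - (c * y / s) * (\<gamma> * (norm q)\<^sup>2)"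
    unfolding drift_w_def Let_def fst_conv snd_conv \<alpha> \<gamma> s_def[symmetric] y_def[symmetric] wedge_scaleR
    using assms(4)
    by (simp add: inner_add_right inner_diff_right inner_ii power2_norm_eq_inner inner_commute[of q p] \<gamma>_def)
  show ?thesis unfolding 1 2 using pos
    by (simp add: power_mult_distrib wd[symmetric] power2_eq_square[of \<gamma>] power2_eq_square[of \<alpha>] algebra_simps
        power2_eq_square[of "wedge q w"])
qed

text \<open>The rotation term does no work. Gravity contributes at most \<open>norm w\<close>,
  because \<open>norm q / s \<le> 1\<close> amounts to \<open>0 \<le> (1 - norm q)^2\<close>; the
  force and its projection contribute \<open>P\<close> each, the vibration \<open>c\<close>. This is
  the origin of the constant in \<open>R\<close>.\<close>

lemma inward_friction:
  assumes "R > 0" "c \<ge> 0" "norm p \<le> P" "norm q \<le> 1" "clip R w = \<alpha> *\<^sub>R w"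
  shows "inner w (q + drift_w \<mu> R p 0 c (q, w)) \<le> norm w * (1 + 2 * P + c) - \<mu> * \<alpha> * (norm w)\<^sup>2"
proof -
  define s where "s = conf_factor q"
  define y where "y = 1 / s - 1"
  have q: "clip 1 q = q" using assms(4) by (intro clip_id) auto
  have s0: "0 < s" using conf_factor_bounds(1)[of q] by (simp add: s_def)
  have y: "0 \<le> y" "y \<le> 1" using conf_factor_inverse_bounds[of q] by (auto simp: s_def y_def)
  have P: "P \<ge> 0" using assms(3) norm_ge_zero[of p] by linarith
  have qs: "norm q / s \<le> 1"
  proof -
    have "s = (1 + (norm q)\<^sup>2) / 2" by (simp add: s_def conf_factor_def q)
    moreover have "0 \<le> (1 - norm q)\<^sup>2" by simp
    ultimately have "norm q \<le> s" by (simp add: power2_eq_square algebra_simps)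
    then show ?thesis using s0 by simp
  qed
  have qw: "\<bar>inner w q / s\<bar> \<le> norm w"
  proof -
    have "\<bar>inner w q\<bar> / s \<le> norm w * norm q / s"
      using s0 by (intro divide_right_mono Cauchy_Schwarz_ineq2) auto
    also have "\<dots> \<le> norm w * 1" using mult_left_mono[OF qs, of "norm w"] by simp
    finally show ?thesis using s0 by simp
  qed
  have eq: "inner w (q + drift_w \<mu> R p 0 c (q, w)) =
      inner w q / s - \<mu> * \<alpha> * (norm w)\<^sup>2 + inner w p - inner p q * (inner w q / s) - c * y * (inner w q / s)"
    unfolding drift_w_def Let_def fst_conv snd_conv q assms(5) s_def[symmetric] y_def[symmetric]
    by (simp add: inner_add_right inner_diff_right inner_ii_self power2_norm_eq_inner)
      (simp add: y_def algebra_simps)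
  have "inner w p \<le> norm w * P"
    using norm_cauchy_schwarz[of w p] mult_left_mono[OF assms(3), of "norm w"] by simp
  moreover have "- (inner p q * (inner w q / s)) \<le> P * norm w"
  proof -
    have "\<bar>inner p q\<bar> \<le> norm p * norm q" by (rule Cauchy_Schwarz_ineq2)
    also have "\<dots> \<le> P * 1" using assms P by (intro mult_mono) auto
    finally have "\<bar>inner p q\<bar> * \<bar>inner w q / s\<bar> \<le> P * norm w" using qw P by (intro mult_mono) auto
    then have "\<bar>inner p q * (inner w q / s)\<bar> \<le> P * norm w" by (simp only: abs_mult)
    then show ?thesis by linarith
  qed
  moreover have "- (c * y * (inner w q / s)) \<le> c * norm w"
  proof -
    have "(c * y) * \<bar>inner w q / s\<bar> \<le> (c * 1) * norm w" using qw y assms by (intro mult_mono) auto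
    then have "\<bar>c * y * (inner w q / s)\<bar> \<le> c * norm w" using y assms by (simp add: abs_mult)
    then show ?thesis by linarith
  qed
  moreover have "inner w q / s \<le> norm w" using qw by linarith
  moreover have "norm w * (1 + 2 * P + c) = norm w + norm w * P + P * norm w + c * norm w"
    by (simp add: algebra_simps)
  ultimately show ?thesis unfolding eq by linarith
qed

text \<open>With \<open>e1 = 0\<close> the velocity \<open>q'\<close> is a positive multiple of
  \<open>w\<close>, so \<open>|q|\<close> is critical exactly where \<open>inner q w = 0\<close>.
  Friction beats everything else once \<open>|w|\<close> exceeds \<open>R - 1\<close>; the extra 1
  in \<open>R\<close> leaves room for the clipping and for nearby solutions.\<close>

lemma averaged_solution_bounds:
  fixes X :: "real \<Rightarrow> complex \<times> complex"
  assumes "T > 0" "\<mu> > 0" "c \<ge> 0" and p: "\<And>t. norm (p t) \<le> P"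
    and R: "R = (1 + 2 * P + c) / \<mu> + 1"
    and per: "\<And>t. X (t + T) = X t"
    and X: "\<And>t. (X has_vector_derivative
      (snd (X t) + drift_q R 0 (X t), fst (X t) + drift_w \<mu> R (p t) 0 c (X t))) (at t)"
  shows "norm (fst (X t)) \<le> 1 - 1 / (2 * (c + 2 * P + 1))" and "norm (snd (X t)) \<le> R - 1"
proof -
  let ?r0 = "1 - 1 / (2 * (c + 2 * P + 1))"
  define q w where "q t = fst (X t)" and "w t = snd (X t)" for t
  have Xqw: "X t = (q t, w t)" for t by (simp add: q_def w_def)
  have P: "P \<ge> 0" using order_trans[OF norm_ge_zero p] .
  then have K: "1 + 2 * P + c > 0" using \<open>c \<ge> 0\<close> by simp
  then have "R > 0" unfolding R using \<open>\<mu> > 0\<close> by (simp add: add_pos_pos)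
  define q' w' where "q' t = w t + drift_q R 0 (q t, w t)"
    and "w' t = q t + drift_w \<mu> R (p t) 0 c (q t, w t)" for t
  have dq: "(q has_vector_derivative q' t) (at t)" for t
    using bounded_linear.has_vector_derivative[OF bounded_linear_fst X[of t]]
    by (simp add: q_def[abs_def] w_def q'_def)
  have dw: "(w has_vector_derivative w' t) (at t)" for t
    using bounded_linear.has_vector_derivative[OF bounded_linear_snd X[of t]]
    by (simp add: q_def w_def[abs_def] w'_def)
  have perq: "q (t + T) = q t" and perw: "w (t + T) = w t" for t by (simp_all add: q_def w_def per)
  have rate: "\<exists>\<beta>>0. inner (q t) (q' t) = \<beta> * inner (q t) (w t)" for t
  proof -
    obtain \<alpha> where \<alpha>: "clip R (w t) = \<alpha> *\<^sub>R w t" "0 < \<alpha>" "\<alpha> \<le> 1"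
      by (rule clip_scaled[OF \<open>R > 0\<close>])
    have "(1 - conf_factor (q t)) * \<alpha> \<le> 1 / 2 * 1"
      using conf_factor_bounds[of "q t"] \<alpha> by (intro mult_mono) auto
    then have "0 < 1 + (conf_factor (q t) - 1) * \<alpha>" by (simp add: algebra_simps)
    moreover have "inner (q t) (q' t) = (1 + (conf_factor (q t) - 1) * \<alpha>) * inner (q t) (w t)"
      by (simp add: q'_def drift_q_def \<alpha> inner_add_right algebra_simps)
    ultimately show ?thesis by blast
  qed
  obtain t0 where t0: "\<And>t. norm (q t) \<le> norm (q t0)" "inner (q t0) (q' t0) = 0"
    using periodic_norm_critical[OF \<open>T > 0\<close> perq dq] by blast
  have "norm (q t0) \<le> ?r0"
  proof (rule ccontr)
    assume "\<not> norm (q t0) \<le> ?r0"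
    then have r: "norm (q t0) > ?r0" by simp
    \<comment> \<open>As \<open>drift_q\<close> involves clipping, \<open>|q|^2\<close> need not be
      twice differentiable, which rules out a second derivative test. But \<open>m\<close> is
      differentiable and has the sign of the derivative of \<open>|q|^2\<close>; increasing through
      0 at \<open>t0\<close>, it forces \<open>|q|\<close> above its maximum.\<close>
    define m where "m t = inner (q t) (w t)" for t
    have m0: "m t0 = 0" using rate[of t0] t0(2) by (auto simp: m_def)
    have dm: "(m has_real_derivative inner (q t) (w' t) + inner (q' t) (w t)) (at t)" for t
      unfolding m_def has_real_derivative_iff_has_vector_derivative
      by (rule bounded_bilinear.has_vector_derivative[OF bounded_bilinear_inner dq dw])
    have "0 < inner (q t0) (w' t0) + inner (q' t0) (w t0)"
      using outward_push[OF \<open>R > 0\<close> \<open>c \<ge> 0\<close> p[of t0] m0[unfolded m_def] r, of \<mu>]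
      by (simp add: q'_def w'_def)
    then obtain d where "d > 0" and d: "\<And>h. 0 < h \<Longrightarrow> h < d \<Longrightarrow> m t0 < m (t0 + h)"
      using DERIV_pos_inc_right[OF dm[of t0]] by blast
    define n where "n t = inner (q t) (q t)" for t
    have dn: "(n has_real_derivative 2 * inner (q t) (q' t)) (at t)" for t
      using bounded_bilinear.has_vector_derivative[OF bounded_bilinear_inner dq[of t] dq[of t]]
      unfolding n_def has_real_derivative_iff_has_vector_derivative
      by (simp add: inner_commute)
    have "n t0 < n (t0 + d / 2)"
    proof (rule DERIV_pos_imp_increasing_open[of t0 "t0 + d / 2" n])
      show "t0 < t0 + d / 2" using \<open>d > 0\<close> by simp
      show "continuous_on {t0..t0 + d / 2} n"
        using dn DERIV_isCont by (auto intro!: continuous_at_imp_continuous_on)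
      fix t assume t: "t0 < t" "t < t0 + d / 2"
      have "m t > 0" using d[of "t - t0"] t \<open>d > 0\<close> m0 by simp
      then have "2 * inner (q t) (q' t) > 0" using rate[of t] by (auto simp: m_def)
      then show "\<exists>y. (n has_real_derivative y) (at t) \<and> 0 < y" using dn by blast
    qed
    then show False using t0(1)[of "t0 + d / 2"] by (simp add: n_def norm_le)
  qed
  then have q0: "norm (q t) \<le> ?r0" for t using t0(1) order_trans by blast
  then show "norm (fst (X t)) \<le> ?r0" unfolding q_def .
  have "?r0 \<le> 1" using P \<open>c \<ge> 0\<close> by simp
  then have q1: "norm (q t) \<le> 1" for t using q0 order_trans by blast
  obtain t1 where t1: "\<And>t. norm (w t) \<le> norm (w t1)" "inner (w t1) (w' t1) = 0"
    using periodic_norm_critical[OF \<open>T > 0\<close> perw dw] by blast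
  obtain \<alpha> where \<alpha>: "clip R (w t1) = \<alpha> *\<^sub>R w t1" "0 < \<alpha>" "\<alpha> \<le> 1" "\<alpha> * norm (w t1) \<le> R"
    "norm (w t1) \<le> R \<Longrightarrow> \<alpha> = 1" "norm (w t1) \<ge> R \<Longrightarrow> \<alpha> * norm (w t1) = R"
    using clip_scaled[OF \<open>R > 0\<close>, of "w t1"] by blast
  let ?N = "norm (w t1)"
  have "0 \<le> ?N * (1 + 2 * P + c) - \<mu> * \<alpha> * ?N\<^sup>2"
    using inward_friction[OF \<open>R > 0\<close> \<open>c \<ge> 0\<close> p[of t1] q1[of t1] \<alpha>(1), of \<mu>] t1(2) by (simp add: w'_def)
  then have *: "0 \<le> ?N * ((1 + 2 * P + c) - \<mu> * (\<alpha> * ?N))" by (simp add: power2_eq_square algebra_simps)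
  have \<mu>R: "\<mu> * (R - 1) = 1 + 2 * P + c" unfolding R using \<open>\<mu> > 0\<close> by simp
  have "?N \<le> R - 1"
  proof (rule ccontr)
    assume "\<not> ?N \<le> R - 1"
    moreover have "R - 1 \<ge> 0" unfolding R using K \<open>\<mu> > 0\<close> by simp
    ultimately have N: "?N > R - 1" "?N > 0" by auto
    \<comment> \<open>If \<open>w\<close> is clipped, its clipped norm is \<open>R\<close>;
      otherwise it is \<open>?N\<close> itself.\<close>
    then have "\<alpha> * ?N > R - 1" using \<alpha>(5,6) by (cases "?N \<le> R") auto
    then have "\<mu> * (\<alpha> * ?N) > \<mu> * (R - 1)" using \<open>\<mu> > 0\<close> by simp
    then have "?N * ((1 + 2 * P + c) - \<mu> * (\<alpha> * ?N)) < 0"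
      using N(2) unfolding \<mu>R by (intro mult_pos_neg) auto
    with * show False by simp
  qed
  then show "norm (snd (X t)) \<le> R - 1" using t1(1) order_trans unfolding w_def by blast
qed

lemma fast_vibration_periodic_solution:
  fixes p :: "real \<Rightarrow> complex" and \<mu> A T :: real
  assumes "T > 0" "\<mu> > 0" and contp: "continuous_on UNIV p" and pT: "\<And>t. p (t + T) = p t"
  obtains k :: nat and R :: real and X :: "real \<Rightarrow> complex \<times> complex"
  where "k \<ge> 1" "R > 0" "\<And>t. X (t + T) = X t"
    "\<And>t. norm (fst (X t)) < 1" "\<And>t. norm (snd (X t)) \<le> R"
    "\<And>t. (X has_vector_derivative
      (snd (X t) + drift_q R (A * cos (2 * pi * k / T * t)) (X t),
       fst (X t) + drift_w \<mu> R (p t) (A * cos (2 * pi * k / T * t)) ((A * cos (2 * pi * k / T * t))\<^sup>2) (X t))) (at t)"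
proof -
  have "compact (p ` {0..T})" by (intro compact_continuous_image continuous_on_subset[OF contp]) auto
  then have "bounded (p ` {0..T})" by (rule compact_imp_bounded)
  then obtain P where P0: "\<And>z. z \<in> p ` {0..T} \<Longrightarrow> norm z \<le> P" unfolding bounded_iff by blast
  have P: "norm (p t) \<le> P" for t
    by (rule periodic_all[of T p "\<lambda>z. norm z \<le> P"]) (use \<open>T > 0\<close> pT P0 in auto)
  have "P \<ge> 0" using order_trans[OF norm_ge_zero P] .
  \<comment> \<open>The mean of \<open>\<eta>^2\<close> for a cosine of amplitude
    \<open>A\<close>.\<close>
  define c where "c = A\<^sup>2 / 2"
  have "c \<ge> 0" by (simp add: c_def)
  define R where "R = (1 + 2 * P + c) / \<mu> + 1"
  have "R > 0" unfolding R_def using \<open>\<mu> > 0\<close> \<open>P \<ge> 0\<close> \<open>c \<ge> 0\<close> by (simp add: add_pos_pos add_nonneg_pos)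
  \<comment> \<open>With the integer \<open>k = Suc n\<close>, the time \<open>T\<close> consists of
    \<open>k\<close> full vibrations, so the vibrating system is \<open>T\<close>-periodic.\<close>
  define \<omega> where "\<omega> n = 2 * pi * real (Suc n) / T" for n
  define e where "e n t = A * cos (\<omega> n * t)" for n t
  define f where "f n t x = drift_q R (e n t) x" for n t x
  define g where "g n t x = drift_w \<mu> R (p t) (e n t) ((e n t)\<^sup>2) x" for n t x
  have eT: "e n (t + T) = e n t" for n t
  proof -
    have "\<omega> n * (t + T) = \<omega> n * t + 2 * pi * of_int (int (Suc n))"
      using \<open>T > 0\<close> by (simp add: \<omega>_def field_simps)
    then have "cos (\<omega> n * (t + T)) = cos (\<omega> n * t)"
      by (simp only: cos_add cos_int_2pin sin_int_2pin mult_1_right mult_zero_right diff_zero)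
    then show ?thesis by (simp add: e_def)
  qed
  have eA: "\<bar>e n t\<bar> \<le> \<bar>A\<bar>" for n t
  proof -
    have "\<bar>A\<bar> * \<bar>cos (\<omega> n * t)\<bar> \<le> \<bar>A\<bar> * 1" by (intro mult_left_mono) auto
    then show ?thesis by (simp add: e_def abs_mult)
  qed
  have e2: "\<bar>(e n t)\<^sup>2\<bar> \<le> A\<^sup>2" for n t
    using eA[of n t] abs_le_square_iff[of "e n t" A] by simp
  \<comment> \<open>One bound for all \<open>n\<close>, since \<open>|A|\<close> bounds the pivot
    velocity at every frequency.\<close>
  define G where "G = max (R + \<bar>A\<bar>) (R * R + 1 + \<mu> * R + P + 2 * P + 2 * \<mu> * \<bar>A\<bar> + \<bar>A\<bar> * R + 2 * A\<^sup>2)"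
  have fG: "norm (f n t x) \<le> G" for n t x
    unfolding f_def G_def using norm_drift_q_le[OF \<open>R > 0\<close> eA] by (rule max.coboundedI1)
  have gG: "norm (g n t x) \<le> G" for n t x
    unfolding g_def G_def using norm_drift_w_le[OF \<open>R > 0\<close> eA e2 P \<open>\<mu> > 0\<close>] by (rule max.coboundedI2)
  have conte: "continuous_on A' (\<lambda>z. e n (h z))" if "continuous_on A' h" for n A' and h :: "real \<times> complex \<times> complex \<Rightarrow> real"
    unfolding e_def by (intro continuous_intros that)
  have contp': "continuous_on A' (\<lambda>z. p (h z))" if "continuous_on A' h" for A' and h :: "real \<times> complex \<times> complex \<Rightarrow> real"
    by (rule continuous_on_compose2[OF contp that]) auto
  have "\<exists>X. (\<forall>t. X (t + T) = X t) \<and>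
      (\<forall>t. (X has_vector_derivative (snd (X t) + f n t (X t), fst (X t) + g n t (X t))) (at t)) \<and>
      (\<forall>t. norm (fst (X t)) \<le> 2 * G) \<and> (\<forall>t. norm (snd (X t)) \<le> 2 * G)" for n
  proof (rule hyperbolic_periodic_solution[of T "f n" G "g n"])
    show "continuous_on UNIV (\<lambda>(t, x). f n t x)"
      unfolding f_def case_prod_unfold by (intro continuous_on_drift_q \<open>R > 0\<close> conte continuous_intros)
    show "continuous_on UNIV (\<lambda>(t, x). g n t x)"
      unfolding g_def case_prod_unfold
      by (intro continuous_on_drift_w \<open>R > 0\<close> conte contp' continuous_on_power continuous_on_fst continuous_on_snd continuous_on_id)
    show "f n (t + T) x = f n t x" "g n (t + T) x = g n t x" for t x
      unfolding f_def g_def eT pT by simp_all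
  qed (use \<open>T > 0\<close> fG gG in auto)
  then obtain x where xT: "\<And>n t. x n (t + T) = x n t"
    and dx: "\<And>n t. (x n has_vector_derivative (snd (x n t) + f n t (x n t), fst (x n t) + g n t (x n t))) (at t)"
    and x1: "\<And>n t. norm (fst (x n t)) \<le> 2 * G" and x2: "\<And>n t. norm (snd (x n t)) \<le> 2 * G"
    by metis
  define F where "F t x = (snd x + drift_q R 0 x, fst x + drift_w \<mu> R (p t) 0 c x)" for t x
  \<comment> \<open>Sorting by harmonics: \<eta> is a pure cosine, and its square splits into the
    mean \<open>c\<close> and a second harmonic. \<open>K1\<close> collects the terms with
    \<open>e1\<close>, \<open>K2\<close> the oscillating part of those with
    \<open>e2\<close>.\<close>
  define K1 where "K1 x = (A *\<^sub>R clip 1 (fst x), - ((A * \<mu> / conf_factor (fst x)) *\<^sub>R clip 1 (fst x)) -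
      (A * (1 / conf_factor (fst x) - 1)) *\<^sub>R clip R (snd x))" for x
  define K2 where "K2 x = (0 :: complex, - ((c * (1 / conf_factor (fst x) - 1) / conf_factor (fst x)) *\<^sub>R clip 1 (fst x)))"
    for x :: "complex \<times> complex"
  have split: "F t x + cos (\<omega> n * t) *\<^sub>R K1 x + cos (2 * \<omega> n * t) *\<^sub>R K2 x =
      (snd x + f n t x, fst x + g n t x)" for n t x
  proof -
    have "(e n t)\<^sup>2 = c + cos (2 * \<omega> n * t) * c"
    proof -
      have "cos (2 * \<omega> n * t) = 2 * (cos (\<omega> n * t))\<^sup>2 - 1"
        using cos_double_cos[of "\<omega> n * t"] by (simp only: mult.assoc)
      then show ?thesis by (simp only:) (simp add: e_def c_def power_mult_distrib field_simps)
    qed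
    then show ?thesis
      unfolding F_def K1_def K2_def f_def g_def drift_q_def drift_w_def Let_def e_def
      by (simp add: algebra_simps add_divide_distrib diff_divide_distrib)
  qed
  have sf: "conf_factor z \<noteq> 0" for z using conf_factor_bounds(1)[of z] by linarith
  have bF: "norm (snd x + f n t x, fst x + g n t x) \<le> norm (fst x) + norm (snd x) + 2 * G" for n t x
    using norm_Pair_le[of "snd x + f n t x" "fst x + g n t x"] norm_triangle_ineq[of "snd x" "f n t x"]
      norm_triangle_ineq[of "fst x" "g n t x"] fG[of n t x] gG[of n t x] by linarith
  obtain X r where r: "strict_mono (r :: nat \<Rightarrow> nat)" and XT: "\<And>t. X (t + T) = X t"
    and dX: "\<And>t. (X has_vector_derivative F t (X t)) (at t)"
    and lim: "uniform_limit {0..T} (\<lambda>n. x (r n)) X sequentially"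
  proof (rule averaging_periodic[of T F K1 K2 \<omega> x "4 * G" "6 * G"])
    show "F (t + T) y = F t y" for t y by (simp add: F_def pT)
    show "continuous_on UNIV (\<lambda>(t, x). F t x)"
      unfolding F_def case_prod_unfold
      by (intro continuous_on_Pair continuous_on_add continuous_on_drift_q continuous_on_drift_w \<open>R > 0\<close> contp'
          continuous_on_const continuous_on_fst continuous_on_snd continuous_on_id)
    show "continuous_on UNIV K1" "continuous_on UNIV K2"
      unfolding K1_def K2_def using \<open>R > 0\<close> sf by (auto intro!: continuous_intros)
    have "filterlim (\<lambda>n. real (Suc n)) at_top sequentially"
      by (rule filterlim_compose[OF filterlim_real_sequentially filterlim_Suc])
    then have "filterlim (\<lambda>n. 2 * pi / T * real (Suc n)) at_top sequentially"
      using \<open>T > 0\<close> by (intro filterlim_tendsto_pos_mult_at_top[OF tendsto_const]) auto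
    then show "filterlim \<omega> at_top sequentially" unfolding \<omega>_def by (simp add: mult_ac)
    show "norm (x n t) \<le> 4 * G" for n t
      using norm_Pair_le[of "fst (x n t)" "snd (x n t)"] x1[of n t] x2[of n t] by simp
    show "(x n has_vector_derivative F t (x n t) + cos (\<omega> n * t) *\<^sub>R K1 (x n t) +
        cos (2 * \<omega> n * t) *\<^sub>R K2 (x n t)) (at t)" for n t
      unfolding split by (rule dx)
    show "norm (F t (x n t) + cos (\<omega> n * t) *\<^sub>R K1 (x n t) + cos (2 * \<omega> n * t) *\<^sub>R K2 (x n t)) \<le> 6 * G" for n t
      unfolding split using bF[of "x n t" n t] x1[of n t] x2[of n t] by linarith
  qed (use \<open>T > 0\<close> xT in auto)
  note bounds = averaged_solution_bounds[OF \<open>T > 0\<close> \<open>\<mu> > 0\<close> \<open>c \<ge> 0\<close> P R_def XT dX[unfolded F_def]]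
  \<comment> \<open>The margins left by the averaged bounds:
    \<open>1 / (2 * (c + 2 * P + 1))\<close> up to the horizon and 1 up to the clipping radius
    \<open>R\<close>.\<close>
  define \<delta> where "\<delta> = min 1 (1 / (2 * (c + 2 * P + 1)))"
  have "\<delta> > 0" using \<open>c \<ge> 0\<close> \<open>P \<ge> 0\<close> by (auto simp: \<delta>_def)
  then obtain n where n: "\<And>t. t \<in> {0..T} \<Longrightarrow> dist (x (r n) t) (X t) < \<delta>"
    using lim unfolding uniform_limit_sequentially_iff by blast
  let ?m = "r n"
  have "norm (fst (x ?m t)) < 1 \<and> norm (snd (x ?m t)) \<le> R" for t
  proof (rule periodic_all[of T "x ?m" "\<lambda>z. norm (fst z) < 1 \<and> norm (snd z) \<le> R"])
    fix t assume "t \<in> {0..T}"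
    then have "norm (x ?m t - X t) < \<delta>" using n by (simp add: dist_norm)
    then have "norm (fst (x ?m t - X t)) < \<delta>" "norm (snd (x ?m t - X t)) < \<delta>"
      by (metis norm_fst_le norm_snd_le prod.collapse le_less_trans)+
    moreover have "norm (fst (x ?m t)) \<le> norm (fst (X t)) + norm (fst (x ?m t - X t))"
      "norm (snd (x ?m t)) \<le> norm (snd (X t)) + norm (snd (x ?m t - X t))"
      unfolding fst_diff snd_diff by (rule norm_triangle_sub)+
    moreover have "\<delta> \<le> 1" "\<delta> \<le> 1 / (2 * (c + 2 * P + 1))" by (simp_all add: \<delta>_def)
    ultimately show "norm (fst (x ?m t)) < 1 \<and> norm (snd (x ?m t)) \<le> R"
      using bounds[of t] by linarith
  qed (use \<open>T > 0\<close> xT in auto)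
  moreover have "2 * pi * real (Suc ?m) / T * t = \<omega> ?m * t" for t by (simp add: \<omega>_def)
  ultimately show thesis
    using that[of "Suc ?m" R "x ?m"] \<open>R > 0\<close> xT dx[of ?m] by (simp add: f_def g_def e_def)
qed

section \<open>Passage to spherical coordinates\<close>

text \<open>
  The chart coordinates are \<open>q = u + \<i> v\<close>, \<open>w = a + \<i> b\<close>; names starting with \<open>d\<close> are time derivatives, and
  \<open>i\<close> is \<open>1 / s\<close>. In space, the vectors \<open>(x, y, z)\<close>, \<open>W\<close> and \<open>V\<close> are position, momentum and velocity on the
  unit sphere. Everything is polynomial modulo the relations \<open>si\<close> and \<open>r2\<close>.
\<close>

locale sphere_algebra =
  fixes u v a b i s \<eta> \<mu> P Q du dv di N k y D da db dN x z Wx Wy Wz Vx Vy Vz \<Lambda> :: real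
  assumes si: "s * i = 1" and r2: "u * u + v * v = 2 * s - 1"
    and du: "du = s * a + \<eta> * u" and dv: "dv = s * b + \<eta> * v"
    and di: "di = - (i * i) * (u * du + v * dv)"
    and N: "N = u * a + v * b" and k: "k = u * b - v * a" and y: "y = i - 1" and D: "D = P * u + Q * v"
    and da: "da = i * u - k * b - \<mu> * a + P - D * i * u - \<mu> * \<eta> * i * u - \<eta> * y * a - \<eta> * \<eta> * y * i * u"
    and db: "db = i * v + k * a - \<mu> * b + Q - D * i * v - \<mu> * \<eta> * i * v - \<eta> * y * b - \<eta> * \<eta> * y * i * v"
    and dN: "dN = du * a + u * da + dv * b + v * db"
    and x: "x = u * i" and z: "z = v * i"
    and Wx: "Wx = a - u * N * i" and Wy: "Wy = - N * i" and Wz: "Wz = b - v * N * i"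
    and Vx: "Vx = Wx + \<eta> * y * x" and Vy: "Vy = Wy - \<eta> * (1 - y * y)" and Vz: "Vz = Wz + \<eta> * y * z"
    and \<Lambda>: "\<Lambda> = Wx * Vx + Wy * Vy + Wz * Vz"
begin

lemma di_eq: "di = Vy"
proof -
  have "u * du + v * dv = s * N + \<eta> * (2 * s - 1)" unfolding du dv N r2[symmetric] by algebra
  then have "di = - (i * i) * (s * N + \<eta> * (2 * s - 1))" unfolding di by simp
  then show ?thesis unfolding Vy Wy y using si by algebra
qed

lemma dx_eq: "du * i + u * di = Vx"
  unfolding di_eq Vx Vy Wx Wy x du using si y by algebra

lemma dz_eq: "dv * i + v * di = Vz"
  unfolding di_eq Vz Vy Wz Wy z dv using si y by algebra

lemma sphere: "x * x + y * y + z * z = 1"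
  unfolding x y z using si r2 by algebra

lemma tangent_W: "x * Wx + y * Wy + z * Wz = 0"
  unfolding Wx Wy Wz x y z N using si r2 by algebra

lemma tangent_V: "x * Vx + y * Vy + z * Vz = 0"
  unfolding Vx Vy Vz using sphere tangent_W by algebra

lemma WW: "Wx * Wx + Wy * Wy + Wz * Wz = a * a + b * b"
  unfolding Wx Wy Wz N using si r2 by algebra

lemma \<Lambda>_eq: "\<Lambda> = a * a + b * b + \<eta> * N * i"
  unfolding \<Lambda> Vx Vy Vz using WW tangent_W Wy by algebra

lemma dN_eq: "dN = (1 - s) * (a * a + b * b) + N * N + (1 - y) * (1 - \<mu> * \<eta> - \<eta> * \<eta> * y) + \<eta> * N * (1 - y) - \<mu> * N + D * y"
  unfolding dN da db du dv k y D N using si r2 by algebra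

text \<open>With \<open>dWx_eq\<close> and \<open>dWz_eq\<close> this is the equation of motion in
  space: \<open>- \<Lambda>\<close> times the position, which keeps \<open>W\<close> tangent, then
  tangential gravity, friction, tangential force, and \<open>- \<eta> * y * V\<close> from the
  turning of the tangent plane. The vertical component comes first because \<open>Wy\<close>
  involves only \<open>N\<close> and \<open>i\<close>; the other two reuse it.\<close>

lemma dWy_eq: "- (dN * i + N * di) = - \<Lambda> * y - (1 - y * y) - \<mu> * Vy - (P * x + Q * z) * y - \<eta> * y * Vy"
  unfolding dN_eq \<Lambda>_eq di_eq Vy Wy x z using si y D by algebra

lemma dWx_eq: "da - (du * N * i + u * dN * i + u * N * di) =
    - \<Lambda> * x + x * y - \<mu> * Vx + P - (P * x + Q * z) * x - \<eta> * y * Vx"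
proof -
  have "du * N * i + u * dN * i + u * N * di = N * (du * i) + u * (dN * i + N * di)" by algebra
  also have "dN * i + N * di = - (- \<Lambda> * y - (1 - y * y) - \<mu> * Vy - (P * x + Q * z) * y - \<eta> * y * Vy)"
    using dWy_eq by algebra
  finally have 1: "du * N * i + u * dN * i + u * N * di = N * (du * i) -
    u * (- \<Lambda> * y - (1 - y * y) - \<mu> * Vy - (P * x + Q * z) * y - \<eta> * y * Vy)" by algebra
  have 2: "du * i = a + \<eta> * x" unfolding du x using si by algebra
  \<comment> \<open>A planar identity that trades the rotation of the frame for \<open>|w|^2\<close>
    and \<open>N\<close>, the quantities in \<open>\<Lambda>_eq\<close>.\<close>
  have 3: "k * b = u * (a * a + b * b) - a * N" unfolding k N by algebra
  show ?thesis unfolding 1 2 da 3 \<Lambda>_eq Vx Vy Wx Wy D x z y by algebra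
qed

lemma dWz_eq: "db - (dv * N * i + v * dN * i + v * N * di) =
    - \<Lambda> * z + z * y - \<mu> * Vz + Q - (P * x + Q * z) * z - \<eta> * y * Vz"
proof -
  have "dv * N * i + v * dN * i + v * N * di = N * (dv * i) + v * (dN * i + N * di)" by algebra
  also have "dN * i + N * di = - (- \<Lambda> * y - (1 - y * y) - \<mu> * Vy - (P * x + Q * z) * y - \<eta> * y * Vy)"
    using dWy_eq by algebra
  finally have 1: "dv * N * i + v * dN * i + v * N * di = N * (dv * i) -
    v * (- \<Lambda> * y - (1 - y * y) - \<mu> * Vy - (P * x + Q * z) * y - \<eta> * y * Vy)" by algebra
  have 2: "dv * i = b + \<eta> * z" unfolding dv z using si by algebra
  have 3: "k * a = b * N - v * (a * a + b * b)" unfolding k N by algebra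
  show ?thesis unfolding 1 2 db 3 \<Lambda>_eq Vz Vy Wz Wy D x z y by algebra
qed

end

section \<open>Hamilton's equations in the angles \<theta> and \<phi>\<close>

context sphere_algebra
begin

lemma p_theta_identity:
  assumes "C \<noteq> 0" and C: "C * C = 1 - z * z"
  shows "(- \<Lambda> * z + z * y - \<mu> * Vz + Q - (P * x + Q * z) * z - \<eta> * y * Vz) / C + Wz * (z * (Vz / C)) / (C * C) =
    - ((x * Vy - y * Vx) / (C * C))\<^sup>2 * C * z - \<eta> * (Vz / C) * C * (y / C)
    - \<eta> * ((x * Vy - y * Vx) / (C * C)) * z * (x / C) - \<mu> * (Vz / C) + z * (y / C) - P * z * (x / C) + Q * C"
proof -
  define j where "j = inverse C"
  define \<Omega> where "\<Omega> = x * Vy - y * Vx"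
  have jC: "j * C = 1" using \<open>C \<noteq> 0\<close> by (simp add: j_def)
  \<comment> \<open>The inner product of \<open>W\<close> and \<open>V\<close> along meridian and
    parallel: the meridian parts are \<open>Wz / C\<close> and \<open>Vz / C\<close>, the parallel
    parts \<open>(\<Omega> + \<eta> * x) / C\<close> and \<open>\<Omega> / C\<close>.\<close>
  have \<Lambda>_polar: "\<Lambda> * (C * C) = Wz * Vz + \<Omega> * \<Omega> + \<eta> * \<Omega> * x"
    unfolding \<Lambda> \<Omega>_def using C sphere tangent_V Vx Vy Vz by algebra
  then have "\<Lambda> = (Wz * Vz + \<Omega> * \<Omega> + \<eta> * \<Omega> * x) * (j * j)" using jC by algebra
  then show ?thesis
    unfolding divide_inverse inverse_mult_distrib j_def[symmetric] \<Omega>_def[symmetric] power2_eq_square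
    using jC C by algebra
qed

lemma phi_rate_identity:
  "x * Wy - y * Wx - \<eta> * x = x * Vy - y * Vx"
  unfolding Vx Vy by algebra

lemma p_phi_identity:
  assumes "C \<noteq> 0" and C: "C * C = 1 - z * z"
  shows "(Vx * Wy + (- \<Lambda> * y - (1 - y * y) - \<mu> * Vy - (P * x + Q * z) * y - \<eta> * y * Vy) * x)
    - (Vy * Wx + (- \<Lambda> * x + x * y - \<mu> * Vx + P - (P * x + Q * z) * x - \<eta> * y * Vx) * y) =
    - \<eta> * (Vz / C) * z * (x / C) - \<eta> * ((x * Vy - y * Vx) / (C * C)) * C * (y / C) - C * (x / C)
    - \<mu> * ((x * Vy - y * Vx) / (C * C)) * C\<^sup>2 - P * C * (y / C)"
proof -
  define j where "j = inverse C"
  have jC: "j * C = 1" using \<open>C \<noteq> 0\<close> by (simp add: j_def)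
  show ?thesis
    unfolding divide_inverse inverse_mult_distrib j_def[symmetric] power2_eq_square
    using jC C sphere tangent_V Vx Vy by algebra
qed

end

lemma sin_cos_half_pi_minus_arctan:
  fixes x y C :: real
  assumes "y > 0" "C > 0" "C * C = x * x + y * y"
  shows "sin (pi / 2 - arctan (x / y)) = y / C" "cos (pi / 2 - arctan (x / y)) = x / C"
proof -
  have "1 + (x / y)\<^sup>2 = (C / y)\<^sup>2"
    using assms by (simp add: field_simps power2_eq_square)
  then have "sqrt (1 + (x / y)\<^sup>2) = C / y" using assms by simp
  then show "sin (pi / 2 - arctan (x / y)) = y / C" "cos (pi / 2 - arctan (x / y)) = x / C"
    using assms by (simp_all add: sin_diff cos_diff cos_arctan sin_arctan)
qed

text \<open>Nothing is clipped here, so the chart equation is the true one. The momentum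
  \<open>p\<theta>\<close> is \<open>Wz / cos \<theta>\<close> since only the meridian direction has
  a \<open>z\<close> component, and \<open>p\<phi>\<close> is the angular momentum about the
  \<open>z\<close> axis. As \<open>y > 0\<close>, a single arctangent gives \<phi>, which is
  therefore periodic itself and not just modulo \<open>2 * pi\<close>.\<close>

lemma pendulum_solution_of_chart:
  fixes X :: "real \<Rightarrow> complex \<times> complex"
  assumes "R > 0" and q1: "\<And>t. norm (fst (X t)) < 1" and wR: "\<And>t. norm (snd (X t)) \<le> R"
    and X: "\<And>t. (X has_vector_derivative
      (snd (X t) + drift_q R (deriv h t) (X t),
       fst (X t) + drift_w \<mu> R (Complex (Px t) (Pz t)) (deriv h t) ((deriv h t)\<^sup>2) (X t))) (at t)"
    and XT: "\<And>t. X (t + T) = X t"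
  shows "\<exists>\<theta> \<phi> p\<theta> p\<phi>. pendulum_solution \<mu> Px Pz h \<theta> \<phi> p\<theta> p\<phi> \<and>
      periodic_fun_simple \<theta> T \<and> periodic_fun_simple \<phi> T \<and>
      periodic_fun_simple p\<theta> T \<and> periodic_fun_simple p\<phi> T \<and>
      (\<forall>t. cos (\<theta> t) * sin (\<phi> t) > 0)"
proof -
  define u v a b where "u t = Re (fst (X t))" and "v t = Im (fst (X t))"
    and "a t = Re (snd (X t))" and "b t = Im (snd (X t))" for t
  define s where "s t = (1 + (u t * u t + v t * v t)) / 2" for t
  define i where "i t = 1 / s t" for t
  define N where "N t = u t * a t + v t * b t" for t
  define x y z where "x t = u t * i t" and "y t = i t - 1" and "z t = v t * i t" for t
  define Wx Wy Wz where "Wx t = a t - u t * N t * i t" and "Wy t = - N t * i t"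
    and "Wz t = b t - v t * N t * i t" for t
  define \<theta> \<phi> p\<theta> p\<phi> where "\<theta> t = arcsin (z t)" and "\<phi> t = pi / 2 - arctan (x t / y t)"
    and "p\<theta> t = Wz t / cos (\<theta> t)" and "p\<phi> t = x t * Wy t - y t * Wx t" for t
  note defs = u_def v_def a_def b_def s_def i_def N_def x_def y_def z_def Wx_def Wy_def Wz_def
    \<theta>_def \<phi>_def p\<theta>_def p\<phi>_def
  have per: "periodic_fun_simple \<theta> T" "periodic_fun_simple \<phi> T"
    "periodic_fun_simple p\<theta> T" "periodic_fun_simple p\<phi> T"
    by (unfold_locales, simp add: defs XT)+
  have point: "cos (\<theta> t) \<noteq> 0 \<and> cos (\<theta> t) * sin (\<phi> t) > 0 \<and>
     (\<theta> has_real_derivative theta_rate (deriv h t) (\<theta> t) (\<phi> t) (p\<theta> t)) (at t) \<and>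
     (\<phi> has_real_derivative phi_rate (deriv h t) (\<theta> t) (\<phi> t) (p\<phi> t)) (at t) \<and>
     (p\<theta> has_real_derivative
        p_theta_rate \<mu> (Px t) (Pz t) (deriv h t) (\<theta> t) (\<phi> t) (p\<theta> t) (p\<phi> t)) (at t) \<and>
     (p\<phi> has_real_derivative
        p_phi_rate \<mu> (Px t) (deriv h t) (\<theta> t) (\<phi> t) (p\<theta> t) (p\<phi> t)) (at t)" for t
  proof -
    define \<eta> where "\<eta> = deriv h t"
    define P Q where "P = Px t" and "Q = Pz t"
    define du dv where "du = s t * a t + \<eta> * u t" and "dv = s t * b t + \<eta> * v t"
    define k D where "k = u t * b t - v t * a t" and "D = P * u t + Q * v t"
    define da where "da = i t * u t - k * b t - \<mu> * a t + P - D * i t * u t - \<mu> * \<eta> * i t * u t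
      - \<eta> * y t * a t - \<eta> * \<eta> * y t * i t * u t"
    define db where "db = i t * v t + k * a t - \<mu> * b t + Q - D * i t * v t - \<mu> * \<eta> * i t * v t
      - \<eta> * y t * b t - \<eta> * \<eta> * y t * i t * v t"
    define di where "di = - (i t * i t) * (u t * du + v t * dv)"
    define dN where "dN = du * a t + u t * da + dv * b t + v t * db"
    define Vx Vy Vz where "Vx = Wx t + \<eta> * y t * x t" and "Vy = Wy t - \<eta> * (1 - y t * y t)"
      and "Vz = Wz t + \<eta> * y t * z t"
    define \<Lambda> where "\<Lambda> = Wx t * Vx + Wy t * Vy + Wz t * Vz"
    have uv: "u t * u t + v t * v t = (norm (fst (X t)))\<^sup>2"
      unfolding cmod_power2 by (simp add: u_def v_def power2_eq_square)
    have "(norm (fst (X t)))\<^sup>2 < 1" using q1[of t] by (simp add: power_less_one_iff)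
    then have uv1: "u t * u t + v t * v t < 1" using uv by simp
    have s0: "s t > 0" unfolding s_def by (simp add: add_pos_nonneg)
    have "s t < 1" unfolding s_def using uv1 by simp
    then have y0: "y t > 0" using s0 by (simp add: y_def i_def)
    have si: "s t * i t = 1" using s0 by (simp add: i_def)
    have r2: "u t * u t + v t * v t = 2 * s t - 1" by (simp only: s_def) (simp add: field_simps)
    interpret sphere_algebra "u t" "v t" "a t" "b t" "i t" "s t" \<eta> \<mu> P Q du dv di "N t" k "y t" D da db dN
      "x t" "z t" "Wx t" "Wy t" "Wz t" Vx Vy Vz \<Lambda>
      by unfold_locales (rule si r2 du_def dv_def di_def N_def k_def y_def D_def da_def db_def dN_def
          x_def z_def Wx_def Wy_def Wz_def Vx_def Vy_def Vz_def \<Lambda>_def)+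
    have clips: "clip 1 (fst (X t)) = fst (X t)" "clip R (snd (X t)) = snd (X t)"
      using clip_id[of 1 "fst (X t)"] clip_id[OF \<open>R > 0\<close> wR[of t]] q1[of t] by simp_all
    have sf: "conf_factor (fst (X t)) = s t" by (simp add: conf_factor_def clips s_def uv)
    have mx: "max 1 (norm (fst (X t))) = 1" using q1[of t] by simp
    have isf: "1 / s t = i t" by (simp add: i_def)
    have q': "snd (X t) + drift_q R \<eta> (X t) = Complex du dv"
      by (simp add: drift_q_def clips sf complex_eq_iff du_def dv_def u_def v_def a_def b_def algebra_simps)
    have w': "fst (X t) + drift_w \<mu> R (Complex P Q) \<eta> (\<eta>\<^sup>2) (X t) = Complex da db"
    proof -
      have "wedge (fst (X t)) (snd (X t)) = k" by (simp add: wedge_def k_def u_def v_def a_def b_def)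
      moreover have "inner (Complex P Q) (fst (X t)) = D" by (simp add: inner_complex_def D_def u_def v_def)
      moreover have "r / s t = r * i t" for r by (simp add: i_def)
      ultimately show ?thesis
        unfolding drift_w_def Let_def clips sf mx
        by (simp add: complex_eq_iff da_def db_def u_def[symmetric] v_def[symmetric] a_def[symmetric] b_def[symmetric]
            y_def power2_eq_square algebra_simps)
    qed
    have dX: "(X has_vector_derivative (Complex du dv, Complex da db)) (at t)"
      using X[of t] unfolding \<eta>_def[symmetric] P_def[symmetric] Q_def[symmetric] q' w' .
    note dfst = bounded_linear.has_vector_derivative[OF bounded_linear_fst dX]
      and dsnd = bounded_linear.has_vector_derivative[OF bounded_linear_snd dX]
    have Du: "(u has_real_derivative du) (at t)" and Dv: "(v has_real_derivative dv) (at t)"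
      and Da: "(a has_real_derivative da) (at t)" and Db: "(b has_real_derivative db) (at t)"
      using bounded_linear.has_vector_derivative[OF bounded_linear_Re dfst]
        bounded_linear.has_vector_derivative[OF bounded_linear_Im dfst]
        bounded_linear.has_vector_derivative[OF bounded_linear_Re dsnd]
        bounded_linear.has_vector_derivative[OF bounded_linear_Im dsnd]
      by (simp_all add: has_real_derivative_iff_has_vector_derivative
          u_def[abs_def] v_def[abs_def] a_def[abs_def] b_def[abs_def])
    have Di: "(i has_real_derivative di) (at t)"
    proof -
      have "((\<lambda>t. 1 / s t) has_real_derivative - s' / (s t * s t)) (at t)"
        if "(s has_real_derivative s') (at t)" for s'
        using that s0 by (auto intro!: derivative_eq_intros)
      moreover have "(s has_real_derivative (u t * du + v t * dv)) (at t)"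
        unfolding s_def[abs_def] by (auto intro!: derivative_eq_intros Du Dv)
      moreover have "- (u t * du + v t * dv) / (s t * s t) = di"
      proof -
        have "- r / (s t * s t) = - (1 / s t * (1 / s t)) * r" for r by simp
        then show ?thesis unfolding di_def i_def .
      qed
      ultimately show ?thesis unfolding i_def[abs_def] by metis
    qed
    have DN: "(N has_real_derivative dN) (at t)"
      unfolding N_def[abs_def] dN_def by (auto intro!: derivative_eq_intros Du Dv Da Db)
    have Dx: "(x has_real_derivative Vx) (at t)"
      unfolding x_def[abs_def] dx_eq[symmetric] by (auto intro!: derivative_eq_intros Du Di)
    have Dz: "(z has_real_derivative Vz) (at t)"
      unfolding z_def[abs_def] dz_eq[symmetric] by (auto intro!: derivative_eq_intros Dv Di)
    have Dy: "(y has_real_derivative Vy) (at t)"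
      unfolding y_def[abs_def] di_eq[symmetric] by (auto intro!: derivative_eq_intros Di)
    have DWx: "(Wx has_real_derivative
        - \<Lambda> * x t + x t * y t - \<mu> * Vx + P - (P * x t + Q * z t) * x t - \<eta> * y t * Vx) (at t)"
      unfolding Wx_def[abs_def] dWx_eq[symmetric]
      by (rule derivative_eq_intros Da Du DN Di refl)+ (simp add: algebra_simps)
    have DWy: "(Wy has_real_derivative
        - \<Lambda> * y t - (1 - y t * y t) - \<mu> * Vy - (P * x t + Q * z t) * y t - \<eta> * y t * Vy) (at t)"
      unfolding Wy_def[abs_def] dWy_eq[symmetric]
      by (rule derivative_eq_intros DN Di refl)+ (simp add: algebra_simps)
    have DWz: "(Wz has_real_derivative
        - \<Lambda> * z t + z t * y t - \<mu> * Vz + Q - (P * x t + Q * z t) * z t - \<eta> * y t * Vz) (at t)"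
      unfolding Wz_def[abs_def] dWz_eq[symmetric]
      by (rule derivative_eq_intros Db Dv DN Di refl)+ (simp add: algebra_simps)
    \<comment> \<open>The poles of the spherical coordinates lie on the horizon, so
      \<open>y > 0\<close> keeps \<open>cos \<theta>\<close> nonzero.\<close>
    have z1: "z t * z t < 1"
      using sphere y0 zero_le_square[of "x t"] mult_pos_pos[OF y0 y0] by linarith
    then have zb: "-1 < z t" "z t < 1" using abs_square_less_1[of "z t"] by (auto simp: power2_eq_square)
    define C where "C = cos (\<theta> t)"
    have C: "C = sqrt (1 - (z t)\<^sup>2)" unfolding C_def \<theta>_def using zb by (simp add: cos_arcsin)
    have C0: "C > 0" unfolding C using z1 by (simp add: power2_eq_square)
    have CC: "C * C = 1 - z t * z t" unfolding C using z1 by (simp add: power2_eq_square)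
    then have CC': "C * C = x t * x t + y t * y t" using sphere by linarith
    have S: "sin (\<theta> t) = z t" unfolding \<theta>_def using zb by simp
    have sin\<phi>: "sin (\<phi> t) = y t / C" and cos\<phi>: "cos (\<phi> t) = x t / C"
      unfolding \<phi>_def using sin_cos_half_pi_minus_arctan[OF y0 C0 CC'] by simp_all
    let ?\<Omega> = "x t * Vy - y t * Vx"
    have th: "theta_rate \<eta> (\<theta> t) (\<phi> t) (p\<theta> t) = Vz / C"
      by (simp add: theta_rate_def S sin\<phi> p\<theta>_def C_def[symmetric] Vz_def add_divide_distrib)
    have ph: "phi_rate \<eta> (\<theta> t) (\<phi> t) (p\<phi> t) = ?\<Omega> / (C * C)"
      using phi_rate_identity C0
      by (simp add: phi_rate_def cos\<phi> p\<phi>_def C_def[symmetric] power2_eq_square)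
    have D\<theta>: "(\<theta> has_real_derivative Vz / C) (at t)"
    proof -
      have "((\<lambda>t. arcsin (z t)) has_real_derivative inverse (sqrt (1 - (z t)\<^sup>2)) * Vz) (at t)"
        by (rule DERIV_chain2[OF DERIV_arcsin Dz]) (use zb in auto)
      then show ?thesis unfolding C \<theta>_def[abs_def] by (simp add: divide_inverse mult.commute)
    qed
    have D\<phi>: "(\<phi> has_real_derivative ?\<Omega> / (C * C)) (at t)"
    proof -
      have "((\<lambda>t. x t / y t) has_real_derivative (Vx * y t - x t * Vy) / (y t * y t)) (at t)"
        using y0 by (intro DERIV_divide Dx Dy) auto
      from DERIV_chain2[OF DERIV_arctan this]
      have "((\<lambda>t. pi / 2 - arctan (x t / y t)) has_real_derivative
          0 - inverse (1 + (x t / y t)\<^sup>2) * ((Vx * y t - x t * Vy) / (y t * y t))) (at t)"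
        by (intro DERIV_diff DERIV_const)
      moreover have "inverse (1 + (x t / y t)\<^sup>2) = y t * y t / (C * C)"
        unfolding CC' using y0 by (simp add: field_simps power2_eq_square)
      moreover have "0 - y t * y t / (C * C) * ((Vx * y t - x t * Vy) / (y t * y t)) = ?\<Omega> / (C * C)"
        using y0 C0 by (simp add: field_simps)
      ultimately show ?thesis unfolding \<phi>_def[abs_def] by simp
    qed
    have D\<theta>p: "(p\<theta> has_real_derivative p_theta_rate \<mu> P Q \<eta> (\<theta> t) (\<phi> t) (p\<theta> t) (p\<phi> t)) (at t)"
    proof -
      let ?W' = "- \<Lambda> * z t + z t * y t - \<mu> * Vz + Q - (P * x t + Q * z t) * z t - \<eta> * y t * Vz"
      have "((\<lambda>t. cos (\<theta> t)) has_real_derivative - sin (\<theta> t) * (Vz / C)) (at t)"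
        by (rule DERIV_chain2[OF DERIV_cos D\<theta>])
      then have "(p\<theta> has_real_derivative (?W' * cos (\<theta> t) - Wz t * (- sin (\<theta> t) * (Vz / C))) / (cos (\<theta> t) * cos (\<theta> t))) (at t)"
        unfolding p\<theta>_def[abs_def] using C0 C_def by (intro DERIV_divide DWz) auto
      moreover have "(?W' * C - Wz t * (- z t * (Vz / C))) / (C * C) = ?W' / C + Wz t * (z t * (Vz / C)) / (C * C)"
        using C0 by (simp add: add_divide_distrib diff_divide_distrib)
      moreover have "\<dots> = p_theta_rate \<mu> P Q \<eta> (\<theta> t) (\<phi> t) (p\<theta> t) (p\<phi> t)"
        unfolding p_theta_rate_def Let_def th ph S sin\<phi> cos\<phi> C_def[symmetric]
        using C0 by (intro p_theta_identity CC) auto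
      ultimately show ?thesis unfolding S C_def[symmetric] by simp
    qed
    have D\<phi>p: "(p\<phi> has_real_derivative p_phi_rate \<mu> P \<eta> (\<theta> t) (\<phi> t) (p\<theta> t) (p\<phi> t)) (at t)"
    proof -
      have eq: "(Vx * Wy t + (- \<Lambda> * y t - (1 - y t * y t) - \<mu> * Vy - (P * x t + Q * z t) * y t - \<eta> * y t * Vy) * x t)
        - (Vy * Wx t + (- \<Lambda> * x t + x t * y t - \<mu> * Vx + P - (P * x t + Q * z t) * x t - \<eta> * y t * Vx) * y t)
        = p_phi_rate \<mu> P \<eta> (\<theta> t) (\<phi> t) (p\<theta> t) (p\<phi> t)"
        unfolding p_phi_rate_def Let_def th ph S sin\<phi> cos\<phi> C_def[symmetric]
        using C0 by (intro p_phi_identity CC) auto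
      have "(p\<phi> has_real_derivative
        (Vx * Wy t + (- \<Lambda> * y t - (1 - y t * y t) - \<mu> * Vy - (P * x t + Q * z t) * y t - \<eta> * y t * Vy) * x t)
        - (Vy * Wx t + (- \<Lambda> * x t + x t * y t - \<mu> * Vx + P - (P * x t + Q * z t) * x t - \<eta> * y t * Vx) * y t)) (at t)"
        unfolding p\<phi>_def[abs_def] by (intro DERIV_diff DERIV_mult Dx Dy DWx DWy)
      then show ?thesis unfolding eq .
    qed
    show ?thesis
      using C0 y0 D\<theta> D\<phi> D\<theta>p D\<phi>p unfolding th[symmetric] ph[symmetric]
      by (simp add: sin\<phi> C_def[symmetric] \<eta>_def P_def Q_def)
  qed
  show ?thesis
    by (intro exI[of _ \<theta>] exI[of _ \<phi>] exI[of _ p\<theta>] exI[of _ p\<phi>])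
      (use per point in \<open>simp add: pendulum_solution_def\<close>)
qed

theorem theorem1:
  fixes \<mu> a T :: real and Px Pz :: "real \<Rightarrow> real"
  assumes "\<mu> > 0" and "a > 0" and "T > 0"
    and "periodic_fun_simple Px T" and "C_infinity Px"
    and "periodic_fun_simple Pz T" and "C_infinity Pz"
  shows "\<exists>\<epsilon>::real. (\<exists>k::nat. k \<ge> 1 \<and> \<epsilon> = 1 / real k) \<and>
    (\<exists>\<theta> \<phi> p\<theta> p\<phi> :: real \<Rightarrow> real.
      pendulum_solution \<mu> Px Pz (pivot_height a T \<epsilon>) \<theta> \<phi> p\<theta> p\<phi> \<and>
      periodic_fun_simple \<theta> T \<and> periodic_fun_simple \<phi> T \<and>
      periodic_fun_simple p\<theta> T \<and> periodic_fun_simple p\<phi> T \<and>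
      (\<forall>t. cos (\<theta> t) * sin (\<phi> t) > 0))"
proof -
  have cont: "continuous_on UNIV f" if "C_infinity f" for f :: "real \<Rightarrow> real"
  proof -
    have "(deriv ^^ 0) f differentiable_on UNIV" using that unfolding C_infinity_def by blast
    then show ?thesis by (simp add: differentiable_imp_continuous_on)
  qed
  define p where "p t = Complex (Px t) (Pz t)" for t
  define A where "A = 2 * pi * a / T"
  have contp: "continuous_on UNIV p"
    unfolding p_def Complex_eq using assms by (intro continuous_intros cont) auto
  have pT: "p (t + T) = p t" for t
    using assms by (simp add: p_def periodic_fun_simple.plus_period)
  obtain k :: nat and R and X :: "real \<Rightarrow> complex \<times> complex" where "k \<ge> 1" "R > 0"
    and XT: "\<And>t. X (t + T) = X t"
    and q: "\<And>t. norm (fst (X t)) < 1" and w: "\<And>t. norm (snd (X t)) \<le> R"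
    and dX: "\<And>t. (X has_vector_derivative
      (snd (X t) + drift_q R (A * cos (2 * pi * k / T * t)) (X t),
       fst (X t) + drift_w \<mu> R (p t) (A * cos (2 * pi * k / T * t)) ((A * cos (2 * pi * k / T * t))\<^sup>2) (X t))) (at t)"
    by (rule fast_vibration_periodic_solution[OF \<open>T > 0\<close> \<open>\<mu> > 0\<close> contp pT]) blast
  define \<epsilon> where "\<epsilon> = 1 / real k"
  have "\<epsilon> \<noteq> 0" using \<open>k \<ge> 1\<close> by (simp add: \<epsilon>_def)
  have "deriv (pivot_height a T \<epsilon>) t = A * cos (2 * pi * k / T * t)" for t
    unfolding deriv_pivot_height[OF \<open>\<epsilon> \<noteq> 0\<close>] by (simp add: A_def \<epsilon>_def mult_ac)
  then have "\<exists>\<theta> \<phi> p\<theta> p\<phi>. pendulum_solution \<mu> Px Pz (pivot_height a T \<epsilon>) \<theta> \<phi> p\<theta> p\<phi> \<and>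
      periodic_fun_simple \<theta> T \<and> periodic_fun_simple \<phi> T \<and>
      periodic_fun_simple p\<theta> T \<and> periodic_fun_simple p\<phi> T \<and>
      (\<forall>t. cos (\<theta> t) * sin (\<phi> t) > 0)"
    using dX unfolding p_def
    by (intro pendulum_solution_of_chart[where X=X and R=R] \<open>R > 0\<close> q w XT) simp
  then show ?thesis using \<open>k \<ge> 1\<close> \<epsilon>_def by blast
qed

end
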